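(* Let $d\ge 3$ be an integer. There exists $a_\star=a_\star(d)>0$ such that, for every nonzero $f\in L^2(\mathbb S^{d-1})$, $$ \frac{\displaystyle \int_{\mathbb R^d} \lvert \widehat{f\sigma}(x)\rvert^4\, \frac{\mathrm d x}{(2\pi)^d} + a_\star\left\lvert \int_{\mathbb S^{d-1}} f(\omega)\, \mathrm d\sigma(\omega)\right\rvert^4}{\lVert f \rVert_{L^2(\mathbb S^{d-1})}^4 } \le \frac{\displaystyle \int_{\mathbb R^d} \lvert \widehat{\sigma}(x)\rvert^4\, \frac{\mathrm d x}{(2\pi)^d} + a_\star\left\lvert \int_{\mathbb S^{d-1}} \mathbf 1(\omega)\, \mathrm d\sigma(\omega)\right\rvert^4}{\lVert \mathbf 1 \rVert_{L^2(\mathbb S^{d-1})}^4}. $$ Moreover, equality holds in this inequality if and only if $f$ is a constant function.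
   Context: $\mathbb S^{d-1}\subset\mathbb R^d$ is the unit sphere with its (unnormalized) surface measure $\sigma$; $L^2(\mathbb S^{d-1})$ is the space of complex-valued functions that are square-integrable with respect to $\sigma$, with functions identified when equal $\sigma$-almost everywhere; $\mathbf 1$ is the constant function $1$. For $f\in L^2(\mathbb S^{d-1})$, the Fourier extension is $$\widehat{f\sigma}(x)=\int_{\mathbb S^{d-1}} f(\omega)e^{i\omega\cdot x}\,\mathrm d\sigma(\omega),\qquad x\in\mathbb R^d,$$ and $\widehat\sigma:=\widehat{\mathbf 1\sigma}$. *)

theory Defs
  imports "HOL-Analysis.Analysis"
begin

text \<open>
  The unnormalized surface measure on the unit sphere. The cone
  \<open>{r *\<^sub>R \<omega> | 0 < r < 1, \<omega> \<in> A}\<close> over a Borel set \<open>A\<close> of the sphere has volume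
  \<open>\<sigma>(A) \<cdot> (integral of r^(d - 1) over (0, 1)) = \<sigma>(A) / d\<close> by polar coordinates, so \<open>\<sigma>\<close> is
  \<open>d\<close> times the image of Lebesgue measure on the punctured unit ball under radial projection.
\<close>

definition sphere_measure :: "(real ^ 'n) measure" where
  "sphere_measure =
     scale_measure (of_nat CARD('n))
       (distr (restrict_space lborel (ball 0 1 - {0}))
              (restrict_space borel (sphere 0 1))
              (\<lambda>x. x /\<^sub>R norm x))"

text \<open>
  Elements of \<open>L\<^sup>2\<close> are represented by functions; identification up to null sets is expressed
  by \<open>AE\<close> wherever it matters. Values of the representatives off the sphere are irrelevant,
  since \<open>sphere_measure\<close> has the sphere as its underlying space.
\<close>

definition L2_sphere :: "(real ^ 'n \<Rightarrow> complex) set" where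
  "L2_sphere = {f. f \<in> borel_measurable sphere_measure
                 \<and> integrable sphere_measure (\<lambda>\<omega>. (cmod (f \<omega>))\<^sup>2)}"

definition L2_sphere_norm :: "(real ^ 'n \<Rightarrow> complex) \<Rightarrow> real" where
  "L2_sphere_norm f = sqrt (\<integral>\<omega>. (cmod (f \<omega>))\<^sup>2 \<partial>sphere_measure)"

definition fourier_extension :: "(real ^ 'n \<Rightarrow> complex) \<Rightarrow> real ^ 'n \<Rightarrow> complex" where
  "fourier_extension f x = (\<integral>\<omega>. f \<omega> * exp (\<i> * complex_of_real (\<omega> \<bullet> x)) \<partial>sphere_measure)"

text \<open>
  The quotient takes values in \<open>[0, \<infinity>]\<close>, so that its upper bound includes the finiteness of the
  integral over \<open>\<real>\<^sup>d\<close>; a real-valued integral would be \<open>0\<close> for a non-integrable integrand.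
\<close>

definition extension_quotient :: "real \<Rightarrow> (real ^ 'n \<Rightarrow> complex) \<Rightarrow> ennreal" where
  "extension_quotient a f =
     ((\<integral>\<^sup>+x. ennreal ((cmod (fourier_extension f x)) ^ 4 / (2 * pi) ^ CARD('n)) \<partial>lborel)
        + ennreal (a * (cmod (\<integral>\<omega>. f \<omega> \<partial>sphere_measure)) ^ 4))
     / ennreal ((L2_sphere_norm f) ^ 4)"

lemma space_sphere_measure [simp]: "space (sphere_measure :: (real ^ 'n) measure) = sphere 0 1"
  by (simp add: sphere_measure_def space_scale_measure space_restrict_space)

lemma sets_sphere_measure [measurable_cong]:
  "sets (sphere_measure :: (real ^ 'n) measure) = sets (restrict_space borel (sphere 0 1))"
  by (simp add: sphere_measure_def)

lemma emeasure_sphere_measure: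
  fixes A :: "(real ^ 'n) set"
  assumes A: "A \<in> sets borel" "A \<subseteq> sphere 0 1"
  shows "emeasure sphere_measure A =
           of_nat CARD('n) * emeasure lborel {x. 0 < norm x \<and> norm x < 1 \<and> x /\<^sub>R norm x \<in> A}"
proof -
  let ?B = "ball 0 1 - {0} :: (real ^ 'n) set"
  let ?p = "\<lambda>x::real ^ 'n. x /\<^sub>R norm x"
  have p: "?p \<in> measurable (restrict_space lborel ?B) (restrict_space borel (sphere 0 1))"
    by (intro measurable_restrict_space2 measurable_restrict_space1)
       (auto simp: space_restrict_space)
  have AS: "A \<in> sets (restrict_space borel (sphere 0 1))"
    using A by (simp add: sets_restrict_space_iff)
  have eq: "?p -` A \<inter> space (restrict_space lborel ?B)
        = {x. 0 < norm x \<and> norm x < 1 \<and> ?p x \<in> A}"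
    by (auto simp: space_restrict_space)
  show ?thesis
    unfolding sphere_measure_def emeasure_scale_measure emeasure_distr[OF p AS] eq
    by (subst emeasure_restrict_space) auto
qed

lemma emeasure_sphere_measure_sphere:
  "emeasure sphere_measure (sphere 0 1 :: (real ^ 'n) set)
     = of_nat CARD('n) * emeasure lborel (ball 0 1 :: (real ^ 'n) set)"
proof -
  have "{x. 0 < norm x \<and> norm x < 1 \<and> x /\<^sub>R norm x \<in> sphere 0 1} = ball 0 1 - {0 :: real ^ 'n}"
    by auto
  moreover have "emeasure lborel (ball 0 1 - {0 :: real ^ 'n}) = emeasure lborel (ball 0 1 :: (real ^ 'n) set)"
    by (rule emeasure_Diff_null_set) auto
  ultimately show ?thesis
    by (subst emeasure_sphere_measure) auto
qed

end

theory Submission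
  imports Defs "HOL-Probability.Probability"
begin

text \<open>
  Write \<open>f = c + g\<close> with \<open>g\<close> of mean zero. In the expansion of \<open>|c T1 + Tg|^4\<close>, with \<open>T\<close> the
  extension operator, the term linear in \<open>g\<close> integrates to zero, since \<open>|T1|^2 T1\<close> is radial, and
  the others are at most \<open>O(|c|^2 \<parallel>g\<parallel>^2 + \<parallel>g\<parallel>^4)\<close> if \<open>T\<close> is bounded from \<open>L^2\<close> to \<open>L^4\<close>. The term
  with \<open>a\<close> falls short of its maximum by a multiple of \<open>a (|c|^2 \<parallel>g\<parallel>^2 + \<parallel>g\<parallel>^4)\<close>, so any
  large \<open>a\<close> works.

  For the bound on \<open>T\<close>, a finite cover of the sphere reduces to \<open>f\<close> supported in a small cap, where
  sums \<open>\<omega> + \<nu>\<close> stay away from \<open>0\<close>. Expanding \<open>|Tf|^4\<close> and integrating against a Gaussian, Schur's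
  test asks for \<open>(\<sigma> \<times> \<sigma>){(\<omega>, \<nu>). |y - \<omega> - \<nu>| \<le> r} = O(r^d)\<close> for \<open>|y| \<ge> 1\<close>: the point \<open>\<omega>\<close> lies in
  a slab of width \<open>2r\<close>, of measure \<open>O(r)\<close> as \<open>d \<ge> 3\<close>, and then \<open>\<nu>\<close> in a cap of measure
  \<open>O(r^(d - 1))\<close>.
\<close>

subsection \<open>Slabs and caps\<close>

text \<open>The convolution square of \<open>\<sigma>\<close> has a density proportional to |y|^(-1)
  (4 - |y|^2)^((d - 3)/2) on |y| < 2. The exponent shows why d = 3 is the threshold: for smaller d
  the density also blows up at |y| = 2. The pole at 0 remains for every d and rules out Schur's test
  on the whole sphere; this is what forces the small caps. The density itself is never computed.
  Bounds for masses of balls take its place, and since \<open>\<sigma>\<close> is defined through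
  cones, they come down to Lebesgue measures of cones. The Gaussian weight makes everything
  absolutely convergent: for f in L^2 the extension is bounded, so weighted integrals can be
  expanded and interchanged freely. All bounds are uniform in the width of the weight, which Fatou's
  lemma finally removes. Only the existence of a is claimed, so constants may be wasteful everywhere
  but at one place: the coefficient of |c|^4 has to be the exact integral of |T1|^4, because the
  inequality is an equality at constants.\<close>

lemma emeasure_lborel_translate:
  fixes S :: "'a::euclidean_space set"
  assumes "S \<in> sets borel"
  shows "emeasure lborel {x. c + x \<in> S} = emeasure lborel S"
proof -
  have "emeasure lborel S = emeasure (distr lborel borel ((+) c)) S"
    by (simp add: lborel_distr_plus)
  also have "\<dots> = emeasure lborel ((+) c -` S \<inter> space lborel)"
    using assms by (intro emeasure_distr) auto
  finally show ?thesis by (simp add: vimage_def)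
qed

text \<open>All translates of \<open>S\<close> have the same volume, so this is Tonelli's theorem.
  It replaces slicing in coordinates adapted to a direction: in the applications \<open>p\<close>
  runs through a line, a plane, or rotated vectors.\<close>

lemma emeasure_average_translates:
  fixes S :: "'a::euclidean_space set" and p :: "'b::euclidean_space \<Rightarrow> 'a"
  assumes [measurable]: "S \<in> sets borel" "Z \<in> sets borel" "p \<in> borel_measurable borel"
  shows "emeasure lborel Z * emeasure lborel S = (\<integral>\<^sup>+x. emeasure lborel {z\<in>Z. x + p z \<in> S} \<partial>lborel)"
proof -
  have tr: "emeasure lborel {x. x + p z \<in> S} = emeasure lborel S" for z
    using emeasure_lborel_translate[OF assms(1), of "p z"] by (simp add: add.commute)
  have "(\<integral>\<^sup>+x. emeasure lborel {z\<in>Z. x + p z \<in> S} \<partial>lborel)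
      = (\<integral>\<^sup>+x. \<integral>\<^sup>+z. indicator Z z * indicator {y. y + p z \<in> S} x \<partial>lborel \<partial>lborel)"
  proof (intro nn_integral_cong)
    fix x :: 'a
    have "emeasure lborel {z\<in>Z. x + p z \<in> S} = (\<integral>\<^sup>+z. indicator {z\<in>Z. x + p z \<in> S} z \<partial>lborel)"
      by (subst nn_integral_indicator) auto
    also have "\<dots> = (\<integral>\<^sup>+z. indicator Z z * indicator {y. y + p z \<in> S} x \<partial>lborel)"
      by (intro nn_integral_cong) (auto simp: indicator_def)
    finally show "emeasure lborel {z\<in>Z. x + p z \<in> S} = \<dots>" .
  qed
  also have "\<dots> = (\<integral>\<^sup>+z. \<integral>\<^sup>+x. indicator Z z * indicator {y. y + p z \<in> S} x \<partial>lborel \<partial>lborel)"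
    by (rule lborel_pair.Fubini') measurable
  also have "\<dots> = (\<integral>\<^sup>+z. indicator Z z * emeasure lborel S \<partial>lborel)"
    by (intro nn_integral_cong) (simp add: nn_integral_cmult tr)
  also have "\<dots> = emeasure lborel Z * emeasure lborel S"
    by (simp add: nn_integral_multc)
  finally show ?thesis by simp
qed

text \<open>\<open>V\<close> catches every base point with a nonempty section, so the averaged
  quantity is at most \<open>M\<close> on \<open>V\<close> and zero elsewhere. Volumes thereby
  reduce to lengths or areas of sections.\<close>

lemma emeasure_le_of_small_sections:
  fixes S V :: "'a::euclidean_space set" and p :: "'b::euclidean_space \<Rightarrow> 'a"
  assumes m: "S \<in> sets borel" "Z \<in> sets borel" "p \<in> borel_measurable borel" "V \<in> sets borel"
    and V: "\<And>x z. z \<in> Z \<Longrightarrow> x + p z \<in> S \<Longrightarrow> x \<in> V"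
    and M: "\<And>x. x \<in> V \<Longrightarrow> emeasure lborel {z\<in>Z. x + p z \<in> S} \<le> M"
  shows "emeasure lborel Z * emeasure lborel S \<le> M * emeasure lborel V"
proof -
  have "emeasure lborel {z\<in>Z. x + p z \<in> S} \<le> M * indicator V x" for x
  proof (cases "x \<in> V")
    case False
    then have "{z\<in>Z. x + p z \<in> S} = {}" using V by auto
    then show ?thesis by (simp only: emeasure_empty zero_le)
  qed (simp add: M)
  then have "(\<integral>\<^sup>+x. emeasure lborel {z\<in>Z. x + p z \<in> S} \<partial>lborel) \<le> (\<integral>\<^sup>+x. M * indicator V x \<partial>lborel)"
    by (intro nn_integral_mono) auto
  also have "\<dots> = M * emeasure lborel V"
    using m by (simp add: nn_integral_cmult_indicator)
  finally show ?thesis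
    by (simp add: emeasure_average_translates[OF m(1-3)])
qed

text \<open>Sections along \<open>e\<close> lie in intervals of length
  \<open>\<beta> - \<alpha>\<close>, and moving by at most one unit enlarges the ball from radius
  \<open>r\<close> to \<open>r + 1\<close>.\<close>

lemma emeasure_ball_slab_le:
  fixes e :: "'a::euclidean_space"
  assumes e: "norm e = 1" and "\<alpha> \<le> \<beta>"
  shows "emeasure lborel {x\<in>ball 0 r. \<alpha> \<le> x \<bullet> e \<and> x \<bullet> e \<le> \<beta>}
       \<le> ennreal (\<beta> - \<alpha>) * emeasure lborel (ball 0 (r + 1) :: 'a set)"
proof -
  let ?S = "{x\<in>ball 0 r. \<alpha> \<le> x \<bullet> e \<and> x \<bullet> e \<le> \<beta>}"
  have ee: "e \<bullet> e = 1" using e by (simp add: norm_eq_1)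
  have "emeasure lborel {0..1::real} * emeasure lborel ?S
      \<le> ennreal (\<beta> - \<alpha>) * emeasure lborel (ball 0 (r + 1) :: 'a set)"
  proof (rule emeasure_le_of_small_sections[where p = "\<lambda>s. s *\<^sub>R e"])
    fix x :: 'a and z :: real assume z: "z \<in> {0..1}" and x: "x + z *\<^sub>R e \<in> ?S"
    have "norm x \<le> norm (x + z *\<^sub>R e) + norm (z *\<^sub>R e)"
      by (metis add_diff_cancel norm_triangle_ineq4)
    with z x e show "x \<in> ball 0 (r + 1)" by auto
  next
    fix x :: 'a
    have "{z \<in> {0..1}. x + z *\<^sub>R e \<in> ?S} \<subseteq> {\<alpha> - x \<bullet> e .. \<beta> - x \<bullet> e}"
      by (auto simp: inner_add_left ee)
    then have "emeasure lborel {z \<in> {0..1}. x + z *\<^sub>R e \<in> ?S} \<le> emeasure lborel {\<alpha> - x \<bullet> e .. \<beta> - x \<bullet> e}"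
      by (intro emeasure_mono) auto
    then show "emeasure lborel {z \<in> {0..1}. x + z *\<^sub>R e \<in> ?S} \<le> ennreal (\<beta> - \<alpha>)"
      using assms by simp
  qed auto
  then show ?thesis by simp
qed

lemma emeasure_annulus_le:
  fixes \<zeta> :: complex
  assumes "A \<le> B"
  shows "emeasure lborel {z. A \<le> (cmod (z - \<zeta>))\<^sup>2 \<and> (cmod (z - \<zeta>))\<^sup>2 \<le> B} \<le> ennreal (pi * (B - A))"
proof (cases "B < 0")
  case True
  then have "{z. A \<le> (cmod (z - \<zeta>))\<^sup>2 \<and> (cmod (z - \<zeta>))\<^sup>2 \<le> B} = {}"
    by (auto simp: not_le) (metis less_le_trans not_less zero_le_power2)
  then show ?thesis by (simp only: emeasure_empty zero_le)
next
  case False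
  \<comment> \<open>\<open>A\<close> may be negative, in which case the annulus is a full disc;
    clipping at 0 makes \<open>sqrt A'\<close> the inner radius in both cases.\<close>
  define A' where "A' = max 0 A"
  have A': "0 \<le> A'" "A \<le> A'" "A' \<le> B" using False assms by (auto simp: A'_def)
  have ball: "emeasure lborel (ball \<zeta> (sqrt t)) = ennreal (pi * t)" if "0 \<le> t" for t
    using that by (simp add: emeasure_ball unit_ball_vol_2)
  have cball: "emeasure lborel (cball \<zeta> (sqrt t)) = ennreal (pi * t)" if "0 \<le> t" for t
    using that by (simp add: emeasure_cball unit_ball_vol_2)
  have "{z. A \<le> (cmod (z - \<zeta>))\<^sup>2 \<and> (cmod (z - \<zeta>))\<^sup>2 \<le> B} \<subseteq> cball \<zeta> (sqrt B) - ball \<zeta> (sqrt A')"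
  proof safe
    fix z assume z: "A \<le> (cmod (z - \<zeta>))\<^sup>2" "(cmod (z - \<zeta>))\<^sup>2 \<le> B"
    then have z': "A' \<le> (cmod (z - \<zeta>))\<^sup>2" by (simp add: A'_def)
    show "z \<in> cball \<zeta> (sqrt B)"
      using z by (simp add: dist_norm norm_minus_commute real_le_rsqrt)
    assume "z \<in> ball \<zeta> (sqrt A')"
    then have "cmod (z - \<zeta>) < sqrt A'" by (simp add: dist_norm norm_minus_commute)
    then have "(cmod (z - \<zeta>))\<^sup>2 < (sqrt A')\<^sup>2"
      by (intro power_strict_mono) auto
    then show False using z' A' by simp
  qed
  then have "emeasure lborel {z. A \<le> (cmod (z - \<zeta>))\<^sup>2 \<and> (cmod (z - \<zeta>))\<^sup>2 \<le> B}
    \<le> emeasure lborel (cball \<zeta> (sqrt B) - ball \<zeta> (sqrt A'))"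
    by (intro emeasure_mono) auto
  also have "\<dots> = emeasure lborel (cball \<zeta> (sqrt B)) - emeasure lborel (ball \<zeta> (sqrt A'))"
  proof (rule emeasure_Diff)
    have "sqrt A' \<le> sqrt B" using A' by simp
    then show "ball \<zeta> (sqrt A') \<subseteq> cball \<zeta> (sqrt B)"
      by (rule subset_trans[OF ball_subset_cball subset_cball])
  qed (use A' in \<open>auto simp: ball\<close>)
  also have "\<dots> = ennreal (pi * B - pi * A')"
    using A' by (simp add: ball cball ennreal_minus)
  also have "\<dots> \<le> ennreal (pi * (B - A))"
    using A' by (intro ennreal_leI) (simp add: algebra_simps)
  finally show ?thesis .
qed

lemma orthonormal_pair_orthogonal_to:
  fixes e :: "'a::euclidean_space"
  assumes "DIM('a) \<ge> 3"
  obtains u v :: 'a where "norm u = 1" "norm v = 1" "u \<bullet> v = 0" "u \<bullet> e = 0" "v \<bullet> e = 0"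
proof -
  have "dim {e} \<le> card {e}" by (rule dim_le_card') simp
  then have "dim {e} < DIM('a)" using assms by simp
  then obtain x where x: "x \<noteq> 0" "\<And>y. y \<in> span {e} \<Longrightarrow> orthogonal x y"
    using orthogonal_to_subspace_exists[of "{e}"] by metis
  have "dim {e, x} \<le> card {e, x}" by (rule dim_le_card') simp
  also have "card {e, x} \<le> 2" by (simp add: card_insert_if)
  finally have "dim {e, x} < DIM('a)" using assms by simp
  then obtain y where y: "y \<noteq> 0" "\<And>z. z \<in> span {e, x} \<Longrightarrow> orthogonal y z"
    using orthogonal_to_subspace_exists[of "{e, x}"] by metis
  show ?thesis
  proof (rule that[of "x /\<^sub>R norm x" "y /\<^sub>R norm y"])
    show "(x /\<^sub>R norm x) \<bullet> (y /\<^sub>R norm y) = 0"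
      using y(2)[of x] by (simp add: span_base orthogonal_def inner_commute)
  qed (use x(1) x(2)[of e] y(1) y(2)[of e] in \<open>auto simp: span_base orthogonal_def\<close>)
qed

text \<open>Translates within a plane orthogonal to \<open>e\<close> meet the slab in an annulus, and the area of an annulus
  is linear in the difference of the squared radii. This plane is where \<open>d \<ge> 3\<close> enters.\<close>

lemma emeasure_cone_slab_le_of_width_le:
  fixes e :: "'a::euclidean_space"
  assumes dim: "DIM('a) \<ge> 3" and e: "norm e = 1" and h: "0 < h" "h \<le> a"
  shows "emeasure lborel {x. 0 < norm x \<and> norm x < 1 \<and> a * norm x \<le> x \<bullet> e \<and> x \<bullet> e \<le> (a + h) * norm x}
    \<le> ennreal (24 * h) * emeasure lborel (ball 0 3 :: 'a set)"
proof -
  let ?S = "{x. 0 < norm x \<and> norm x < 1 \<and> a * norm x \<le> x \<bullet> e \<and> x \<bullet> e \<le> (a + h) * norm x}"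
  \<comment> \<open>A section has area O(h / a), which is poor for small \<open>a\<close>, but the
    volume of \<open>?V\<close> is O(a), and the product is O(h). That height \<open>2 * a\<close>
    is enough for \<open>?V\<close> uses \<open>h \<le> a\<close>.\<close>
  let ?V = "{x\<in>ball 0 2. 0 \<le> x \<bullet> e \<and> x \<bullet> e \<le> 2 * a}"
  obtain u v :: 'a where uv: "norm u = 1" "norm v = 1" "u \<bullet> v = 0" "u \<bullet> e = 0" "v \<bullet> e = 0"
    using orthonormal_pair_orthogonal_to[OF dim] by blast
  define p where "p z = Re z *\<^sub>R u + Im z *\<^sub>R v" for z
  have uu: "u \<bullet> u = 1" "v \<bullet> v = 1" "v \<bullet> u = 0" using uv by (auto simp: norm_eq_1 inner_commute)
  have pp: "p z \<bullet> p z = (cmod z)\<^sup>2" "p z \<bullet> e = 0" for z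
    by (auto simp: p_def inner_add_left inner_add_right uv uu cmod_power2 simp flip: power2_eq_square)
  then have norm_p: "norm (p z) = cmod z" for z
    by (simp add: norm_eq_sqrt_inner)
  have a: "0 < a" using h by simp
  have "emeasure lborel (cball 0 1 :: complex set) * emeasure lborel ?S
      \<le> ennreal (12 * pi * (h / a)) * emeasure lborel ?V"
  proof (rule emeasure_le_of_small_sections[where p = p])
    show "?S \<in> sets borel" "?V \<in> sets borel" by measurable
    show "p \<in> borel_measurable borel" unfolding p_def by measurable
  next
    fix x z assume z: "z \<in> cball 0 1" and x: "x + p z \<in> ?S"
    have "norm x \<le> norm (x + p z) + norm (p z)"
      by (metis add_diff_cancel norm_triangle_ineq4)
    moreover have "norm (p z) \<le> 1" using z by (simp add: norm_p)
    moreover have "norm (x + p z) < 1" using x by simp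
    ultimately have "norm x < 2" by simp
    have xe: "(x + p z) \<bullet> e = x \<bullet> e" by (simp add: inner_add_left pp)
    from x have "a * norm (x + p z) \<le> (x + p z) \<bullet> e" "(x + p z) \<bullet> e \<le> (a + h) * norm (x + p z)"
      by blast+
    then have "a * norm (x + p z) \<le> x \<bullet> e" "x \<bullet> e \<le> (a + h) * norm (x + p z)"
      unfolding xe .
    moreover have "0 \<le> a * norm (x + p z)" using a by simp
    moreover have "(a + h) * norm (x + p z) \<le> a + h"
      using a h x mult_left_mono[of "norm (x + p z)" 1 "a + h"] by simp
    ultimately have "0 \<le> x \<bullet> e" "x \<bullet> e \<le> 2 * a" using h by linarith+
    with \<open>norm x < 2\<close> show "x \<in> ?V" by simp
  next
    fix x assume x: "x \<in> ?V"
    define t where "t = x \<bullet> e"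
    have t: "0 \<le> t" "t \<le> 2 * a" using x by (auto simp: t_def)
    \<comment> \<open>Completing the square in the plane of \<open>u\<close> and \<open>v\<close>:
      \<open>\<zeta>\<close> is minus the projection of \<open>x\<close> and \<open>k\<close> the
      squared distance of \<open>x\<close> from the plane, so the norm of \<open>x + p z\<close>
      determines the distance of \<open>z\<close> from \<open>\<zeta>\<close>.\<close>
    define \<zeta> where "\<zeta> = - Complex (x \<bullet> u) (x \<bullet> v)"
    define k where "k = (norm x)\<^sup>2 - (cmod \<zeta>)\<^sup>2"
    have nx: "(norm (x + p z))\<^sup>2 = (cmod (z - \<zeta>))\<^sup>2 + k" for z
    proof -
      have "(norm (x + p z))\<^sup>2 = (norm x)\<^sup>2 + 2 * (x \<bullet> p z) + (cmod z)\<^sup>2"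
        by (simp add: power2_norm_eq_inner inner_add_left inner_add_right pp inner_commute)
      also have "\<dots> = (cmod (z - \<zeta>))\<^sup>2 + k"
        unfolding k_def \<zeta>_def p_def cmod_power2
        by (simp add: inner_add_right power2_eq_square algebra_simps)
      finally show ?thesis .
    qed
    \<comment> \<open>The inner product with \<open>e\<close> has the same value \<open>t\<close>
      for every \<open>z\<close>, so the two cone inequalities confine the norm of
      \<open>x + p z\<close> to the interval from \<open>t / (a + h)\<close> to
      \<open>t / a\<close>.\<close>
    define A where "A = (t / (a + h))\<^sup>2 - k"
    define B where "B = (t / a)\<^sup>2 - k"
    have AB: "A \<le> B" unfolding A_def B_def using t a h by (auto intro!: power_mono divide_left_mono)
    have "{z\<in>cball 0 1. x + p z \<in> ?S} \<subseteq> {z. A \<le> (cmod (z - \<zeta>))\<^sup>2 \<and> (cmod (z - \<zeta>))\<^sup>2 \<le> B}"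
    proof safe
      fix z assume z: "a * norm (x + p z) \<le> (x + p z) \<bullet> e" "(x + p z) \<bullet> e \<le> (a + h) * norm (x + p z)"
      have te: "(x + p z) \<bullet> e = t" by (simp add: inner_add_left pp t_def)
      have "norm (x + p z) \<le> t / a" using z(1) a unfolding te by (simp add: field_simps)
      then have "(norm (x + p z))\<^sup>2 \<le> (t / a)\<^sup>2" by (intro power_mono) auto
      then show "(cmod (z - \<zeta>))\<^sup>2 \<le> B" unfolding B_def using nx[of z] by simp
      have "t / (a + h) \<le> norm (x + p z)" using z(2) a h unfolding te by (simp add: field_simps)
      then have "(t / (a + h))\<^sup>2 \<le> (norm (x + p z))\<^sup>2" using t a h by (intro power_mono) auto
      then show "A \<le> (cmod (z - \<zeta>))\<^sup>2" unfolding A_def using nx[of z] by simp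
    qed
    then have "emeasure lborel {z\<in>cball 0 1. x + p z \<in> ?S} \<le> 
       emeasure lborel {z. A \<le> (cmod (z - \<zeta>))\<^sup>2 \<and> (cmod (z - \<zeta>))\<^sup>2 \<le> B}"
      by (intro emeasure_mono) auto
    also have "\<dots> \<le> ennreal (pi * (B - A))" by (rule emeasure_annulus_le[OF AB])
    also have "\<dots> \<le> ennreal (12 * pi * (h / a))"
    proof (intro ennreal_leI)
      have "B - A = t\<^sup>2 / a\<^sup>2 - t\<^sup>2 / (a + h)\<^sup>2"
        by (simp add: A_def B_def power_divide)
      also have "\<dots> = t\<^sup>2 * ((a + h)\<^sup>2 - a\<^sup>2) / (a\<^sup>2 * (a + h)\<^sup>2)"
        using a h by (subst diff_frac_eq) (auto simp: right_diff_distrib)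
      also have "(a + h)\<^sup>2 - a\<^sup>2 = h * (2 * a + h)"
        by (simp add: power2_eq_square algebra_simps)
      also have "t\<^sup>2 * (h * (2 * a + h)) / (a\<^sup>2 * (a + h)\<^sup>2) \<le> (2 * a)\<^sup>2 * (h * (2 * a + a)) / (a\<^sup>2 * a\<^sup>2)"
        using t a h by (intro frac_le mult_mono power_mono mult_pos_pos) auto
      also have "\<dots> = 12 * (h / a)" using a by (simp add: field_simps power2_eq_square)
      finally have "pi * (B - A) \<le> pi * (12 * (h / a))" by (intro mult_left_mono) auto
      then show "pi * (B - A) \<le> 12 * pi * (h / a)" by (simp add: algebra_simps)
    qed
    finally show "emeasure lborel {z\<in>cball 0 1. x + p z \<in> ?S} \<le> ennreal (12 * pi * (h / a))" .
  qed auto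
  also have "\<dots> \<le> ennreal (12 * pi * (h / a)) * (ennreal (2 * a) * emeasure lborel (ball 0 3 :: 'a set))"
    using emeasure_ball_slab_le[OF e, of 0 "2 * a" 2] a by (intro mult_left_mono) auto
  also have "\<dots> = ennreal pi * (ennreal (24 * h) * emeasure lborel (ball 0 3 :: 'a set))"
  proof -
    have "12 * pi * (h / a) * (2 * a) = pi * (24 * h)" using a by simp
    then have "ennreal (12 * pi * (h / a)) * ennreal (2 * a) = ennreal pi * ennreal (24 * h)"
      using a h by (subst (1 2) ennreal_mult[symmetric]) auto
    then show ?thesis by (simp only: mult.assoc[symmetric])
  qed
  finally have "ennreal pi * emeasure lborel ?S \<le> ennreal pi * (ennreal (24 * h) * emeasure lborel (ball 0 3 :: 'a set))"
    by (simp add: emeasure_cball unit_ball_vol_2)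
  then show ?thesis
    by (subst (asm) ennreal_mult_le_mult_iff) auto
qed

text \<open>Away from the equator, relative to the width \<open>h\<close>, the previous bound
  applies, after reflecting \<open>e\<close> to \<open>- e\<close> if \<open>a\<close> is negative.
  Near the equator, with \<open>a\<close> between \<open>- (2 * h)\<close> and \<open>2 * h\<close>,
  the cone lies in a flat slab of half-width \<open>3 * h\<close>.\<close>

lemma emeasure_cone_slab_le:
  fixes e :: "'a::euclidean_space"
  assumes dim: "DIM('a) \<ge> 3" and e: "norm e = 1" and h: "0 < h"
  shows "emeasure lborel {x. 0 < norm x \<and> norm x < 1 \<and> a * norm x \<le> x \<bullet> e \<and> x \<bullet> e \<le> (a + h) * norm x}
    \<le> ennreal (24 * h) * emeasure lborel (ball 0 3 :: 'a set)"
proof -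
  let ?S = "{x. 0 < norm x \<and> norm x < 1 \<and> a * norm x \<le> x \<bullet> e \<and> x \<bullet> e \<le> (a + h) * norm x}"
  consider "h \<le> a" | "h \<le> - a - h" | "- (2 * h) \<le> a" "a \<le> 2 * h" using h by linarith
  then show ?thesis
  proof cases
    case 1 then show ?thesis by (rule emeasure_cone_slab_le_of_width_le[OF dim e h])
  next
    case 2
    have "?S = {x. 0 < norm x \<and> norm x < 1 \<and> (- a - h) * norm x \<le> x \<bullet> (- e) \<and> x \<bullet> (- e) \<le> (- a - h + h) * norm x}"
      by (auto simp: algebra_simps)
    then show ?thesis using emeasure_cone_slab_le_of_width_le[OF dim _ h 2, of "- e"] e by simp
  next
    case 3
    have "?S \<subseteq> {x\<in>ball 0 1. - (3 * h) \<le> x \<bullet> e \<and> x \<bullet> e \<le> 3 * h}"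
    proof safe
      fix x assume x: "0 < norm x" "norm x < 1" "a * norm x \<le> x \<bullet> e" "x \<bullet> e \<le> (a + h) * norm x"
      show "x \<in> ball 0 1" using x by simp
      have "- (3 * h) * 1 \<le> - (3 * h) * norm x" using x h by (simp add: mult_left_le)
      also have "\<dots> \<le> a * norm x" using 3 h by (intro mult_right_mono) auto
      finally show "- (3 * h) \<le> x \<bullet> e" using x by simp
      have "(a + h) * norm x \<le> (3 * h) * norm x" using 3 by (intro mult_right_mono) auto
      also have "\<dots> \<le> 3 * h * 1" using x h by (intro mult_left_mono) auto
      finally show "x \<bullet> e \<le> 3 * h" using x by simp
    qed
    then have "emeasure lborel ?S \<le> emeasure lborel {x\<in>ball 0 1. - (3 * h) \<le> x \<bullet> e \<and> x \<bullet> e \<le> 3 * h}"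
      by (intro emeasure_mono) auto
    also have "\<dots> \<le> ennreal (3 * h - - (3 * h)) * emeasure lborel (ball 0 (1 + 1) :: 'a set)"
      using e h by (intro emeasure_ball_slab_le) auto
    also have "\<dots> \<le> ennreal (24 * h) * emeasure lborel (ball 0 3 :: 'a set)"
      using h by (intro mult_mono ennreal_leI emeasure_mono) auto
    finally show ?thesis .
  qed
qed

text \<open>The cone over a cap of radius \<open>r\<close> stays within \<open>r\<close> of the
  segment from 0 to \<open>p\<close>, hence is covered by about \<open>1 / r\<close> balls of radius
  O(r), each of volume O(r^d). The centre \<open>p\<close> is arbitrary because the caps to be
  measured are centred at points \<open>y - \<omega>\<close>.\<close>

lemma emeasure_cone_cap_le:
  fixes p :: "'a::euclidean_space"
  assumes r: "0 < r" "r \<le> 1"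
  shows "emeasure lborel {x. 0 < norm x \<and> norm x < 1 \<and> norm (x /\<^sub>R norm x - p) \<le> r}
    \<le> ennreal (2 * 4 ^ DIM('a) * unit_ball_vol (DIM('a)) * r ^ (DIM('a) - 1))" (is "emeasure _ ?S \<le> _")
proof (cases "?S = {}")
  case False
  define m where "m = nat \<lfloor>1 / r\<rfloor>"
  have m: "real m \<le> 1 / r" "1 / r < real m + 1" using r by (auto simp: m_def)
  from False obtain x0 where x0: "0 < norm x0" "norm (x0 /\<^sub>R norm x0 - p) \<le> r" by auto
  have "norm p \<le> norm (x0 /\<^sub>R norm x0 - p) + norm (x0 /\<^sub>R norm x0)"
    by (metis norm_minus_commute norm_triangle_sub add.commute)
  also have "norm (x0 /\<^sub>R norm x0) = 1" using x0 by simp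
  finally have p: "norm p \<le> 2" using x0 r by simp
  \<comment> \<open>The radius allows at most \<open>r\<close> from \<open>x\<close> to the point
    \<open>norm x *\<^sub>R p\<close> of the segment and at most \<open>2 * r\<close> from there to
    a centre, since \<open>norm p \<le> 2\<close>.\<close>
  have "?S \<subseteq> (\<Union>j\<in>{0..m}. cball ((real j * r) *\<^sub>R p) (4 * r))"
  proof
    fix x assume "x \<in> ?S"
    then have x: "0 < norm x" "norm x < 1" "norm (x /\<^sub>R norm x - p) \<le> r" by auto
    define j where "j = nat \<lfloor>norm x / r\<rfloor>"
    have j: "real j \<le> norm x / r" "norm x / r < real j + 1" using r by (auto simp: j_def)
    have "norm x / r \<le> 1 / r" using x r by (intro divide_right_mono) auto
    with j have "j \<le> m" unfolding j_def m_def by (intro nat_mono floor_mono)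
    have "norm (x - norm x *\<^sub>R p) = norm x * norm (x /\<^sub>R norm x - p)"
    proof -
      have "x - norm x *\<^sub>R p = norm x *\<^sub>R (x /\<^sub>R norm x - p)" using x by (simp add: scaleR_diff_right)
      then show ?thesis by (metis abs_norm_cancel norm_scaleR)
    qed
    also have "\<dots> \<le> 1 * r" using x r by (intro mult_mono) auto
    finally have 1: "norm (x - norm x *\<^sub>R p) \<le> r" by simp
    have "\<bar>norm x - real j * r\<bar> \<le> r" using j r by (auto simp: field_simps abs_le_iff)
    then have 2: "norm (norm x *\<^sub>R p - (real j * r) *\<^sub>R p) \<le> r * 2"
      unfolding scaleR_diff_left[symmetric] norm_scaleR using p r by (intro mult_mono) auto
    have "norm (x - (real j * r) *\<^sub>R p) \<le> norm (x - norm x *\<^sub>R p) + norm (norm x *\<^sub>R p - (real j * r) *\<^sub>R p)"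
      using norm_triangle_ineq[of "x - norm x *\<^sub>R p" "norm x *\<^sub>R p - (real j * r) *\<^sub>R p"] by simp
    with 1 2 r have "norm (x - (real j * r) *\<^sub>R p) \<le> 4 * r" by simp
    then show "x \<in> (\<Union>j\<in>{0..m}. cball ((real j * r) *\<^sub>R p) (4 * r))"
      using \<open>j \<le> m\<close> by (intro UN_I[of j]) (auto simp: dist_norm norm_minus_commute)
  qed
  then have "emeasure lborel ?S \<le> emeasure lborel (\<Union>j\<in>{0..m}. cball ((real j * r) *\<^sub>R p) (4 * r))"
    by (intro emeasure_mono) auto
  also have "\<dots> \<le> (\<Sum>j\<in>{0..m}. emeasure lborel (cball ((real j * r) *\<^sub>R p) (4 * r)))"
    by (intro emeasure_subadditive_finite) auto
  also have "\<dots> = ennreal ((real m + 1) * (unit_ball_vol (DIM('a)) * (4 * r) ^ DIM('a)))"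
    using r by (simp add: emeasure_cball ennreal_mult ennreal_of_nat_eq_real_of_nat[symmetric] add.commute)
  also have "\<dots> \<le> ennreal (2 * 4 ^ DIM('a) * unit_ball_vol (DIM('a)) * r ^ (DIM('a) - 1))"
  proof (intro ennreal_leI)
    have "(4 * r) ^ DIM('a) = 4 ^ DIM('a) * (r ^ (DIM('a) - 1) * r)"
      using power_minus_mult[of "DIM('a)" r] by (simp add: power_mult_distrib)
    then have "(real m + 1) * (unit_ball_vol (DIM('a)) * (4 * r) ^ DIM('a))
      = ((real m + 1) * r) * (4 ^ DIM('a) * unit_ball_vol (DIM('a)) * r ^ (DIM('a) - 1))" by (simp add: algebra_simps)
    also have "\<dots> \<le> 2 * (4 ^ DIM('a) * unit_ball_vol (DIM('a)) * r ^ (DIM('a) - 1))"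
    proof (intro mult_right_mono)
      have "real m * r \<le> 1" using m r by (simp add: field_simps)
      then show "(real m + 1) * r \<le> 2" using r by (simp add: algebra_simps)
    qed (use r in auto)
    finally show "(real m + 1) * (unit_ball_vol (DIM('a)) * (4 * r) ^ DIM('a))
      \<le> 2 * 4 ^ DIM('a) * unit_ball_vol (DIM('a)) * r ^ (DIM('a) - 1)" by (simp add: algebra_simps)
  qed
  finally show ?thesis .
qed (simp only: emeasure_empty zero_le)

subsection \<open>The surface measure\<close>

text \<open>With this congruence rule, the measurability prover rewrites \<open>sphere_measure\<close> to the restricted
  Borel space, and rules stated for \<open>sphere_measure\<close> no longer match.\<close>

declare sets_sphere_measure [measurable_cong del]

lemma measurable_sphere_ident [measurable]:
  "(\<lambda>x. x) \<in> measurable (sphere_measure :: (real ^ 'n) measure) borel"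
  by (simp add: measurable_cong_sets[OF sets_sphere_measure refl] measurable_restrict_space1)

lemma sets_sphere_measureI [measurable]: "A \<in> sets borel \<Longrightarrow> A \<inter> sphere 0 1 \<in> sets sphere_measure"
  by (auto simp: sets_sphere_measure sets_restrict_space)

lemma finite_measure_sphere: "finite_measure (sphere_measure :: (real ^ 'n) measure)"
proof
  show "emeasure sphere_measure (space (sphere_measure :: (real ^ 'n) measure)) \<noteq> \<infinity>"
    by (simp add: emeasure_sphere_measure_sphere emeasure_ball ennreal_of_nat_eq_real_of_nat ennreal_mult[symmetric])
qed

interpretation sphere: finite_measure "sphere_measure :: (real ^ 'n) measure"
  by (rule finite_measure_sphere)

interpretation sphere2: pair_sigma_finite "sphere_measure :: (real ^ 'n) measure" "sphere_measure :: (real ^ 'n) measure" ..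

lemma measure_sphere_pos: "0 < measure sphere_measure (sphere 0 1 :: (real ^ 'n) set)"
proof -
  have "measure sphere_measure (sphere 0 1 :: (real ^ 'n) set) = CARD('n) * unit_ball_vol (CARD('n))"
    unfolding measure_def
    by (simp add: emeasure_sphere_measure_sphere emeasure_ball ennreal_of_nat_eq_real_of_nat ennreal_mult[symmetric])
  then show ?thesis by simp
qed

lemma emeasure_sphere_cap_le:
  fixes p :: "real ^ 'n"
  assumes r: "0 < r" "r \<le> 1"
  shows "emeasure sphere_measure (cball p r \<inter> sphere 0 1)
    \<le> ennreal (CARD('n) * (2 * 4 ^ CARD('n) * unit_ball_vol (CARD('n))) * r ^ (CARD('n) - 1))"
proof -
  have "emeasure sphere_measure (cball p r \<inter> sphere 0 1)
    = of_nat CARD('n) * emeasure lborel {x. 0 < norm x \<and> norm x < 1 \<and> x /\<^sub>R norm x \<in> cball p r \<inter> sphere 0 1}"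
    by (rule emeasure_sphere_measure) auto
  also have "{x. 0 < norm x \<and> norm x < 1 \<and> x /\<^sub>R norm x \<in> cball p r \<inter> sphere 0 1}
    = {x. 0 < norm x \<and> norm x < 1 \<and> norm (x /\<^sub>R norm x - p) \<le> r}"
    by (auto simp: dist_norm norm_minus_commute)
  also have "of_nat CARD('n) * emeasure lborel \<dots>
     \<le> of_nat CARD('n) * ennreal (2 * 4 ^ DIM(real ^ 'n) * unit_ball_vol (DIM(real ^ 'n)) * r ^ (DIM(real ^ 'n) - 1))"
    using emeasure_cone_cap_le[OF r, of p] by (intro mult_left_mono) auto
  also have "\<dots> = ennreal (CARD('n) * (2 * 4 ^ CARD('n) * unit_ball_vol (CARD('n))) * r ^ (CARD('n) - 1))"
    using r by (simp add: ennreal_of_nat_eq_real_of_nat ennreal_mult[symmetric] mult.assoc)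
  finally show ?thesis .
qed

lemma emeasure_sphere_slab_le:
  fixes e :: "real ^ 'n"
  assumes dim: "CARD('n) \<ge> 3" and e: "norm e = 1" and h: "0 < h"
  shows "emeasure sphere_measure ({\<omega>. a \<le> \<omega> \<bullet> e \<and> \<omega> \<bullet> e \<le> a + h} \<inter> sphere 0 1)
    \<le> ennreal (CARD('n) * (24 * unit_ball_vol (CARD('n)) * 3 ^ CARD('n)) * h)"
proof -
  have "emeasure sphere_measure ({\<omega>. a \<le> \<omega> \<bullet> e \<and> \<omega> \<bullet> e \<le> a + h} \<inter> sphere 0 1)
    = of_nat CARD('n) * emeasure lborel {x. 0 < norm x \<and> norm x < 1 \<and>
        x /\<^sub>R norm x \<in> {\<omega>. a \<le> \<omega> \<bullet> e \<and> \<omega> \<bullet> e \<le> a + h} \<inter> sphere 0 1}"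
    by (rule emeasure_sphere_measure) auto
  also have "{x. 0 < norm x \<and> norm x < 1 \<and> x /\<^sub>R norm x \<in> {\<omega>. a \<le> \<omega> \<bullet> e \<and> \<omega> \<bullet> e \<le> a + h} \<inter> sphere 0 1}
    = {x. 0 < norm x \<and> norm x < 1 \<and> a * norm x \<le> x \<bullet> e \<and> x \<bullet> e \<le> (a + h) * norm x}"
    by (auto simp: field_simps)
  also have "of_nat CARD('n) * emeasure lborel \<dots>
     \<le> of_nat CARD('n) * (ennreal (24 * h) * emeasure lborel (ball 0 3 :: (real ^ 'n) set))"
    using emeasure_cone_slab_le[OF _ e h, of a] dim by (intro mult_left_mono) auto
  also have "\<dots> = ennreal (CARD('n) * (24 * unit_ball_vol (CARD('n)) * 3 ^ CARD('n)) * h)"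
    using h by (simp add: emeasure_ball ennreal_of_nat_eq_real_of_nat ennreal_mult[symmetric] algebra_simps)
  finally show ?thesis .
qed

section \<open>The convolution square of the surface measure\<close>

text \<open>In effect, the convolution square of \<open>\<sigma>\<close> has bounded density away
  from the unit ball. For \<open>r \<le> 1\<close> the factors \<open>K\<close> and
  \<open>2 * L\<close> come from the cap and the slab; for larger \<open>r\<close> the total mass
  \<open>\<mu> * \<mu>\<close> is bound enough.\<close>

lemma sphere_convolution_ball_le:
  assumes dim: "CARD('n::finite) \<ge> 3"
  obtains C where "C \<ge> 0" and "\<And>(y :: real ^ 'n) r. 1 \<le> norm y \<Longrightarrow> 0 < r \<Longrightarrow>
    (\<integral>\<^sup>+\<omega>. \<integral>\<^sup>+\<nu>. indicator (cball y r) (\<omega> + \<nu>) \<partial>sphere_measure \<partial>sphere_measure) \<le> ennreal (C * r ^ CARD('n))"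
proof -
  define K where "K = CARD('n) * (2 * 4 ^ CARD('n) * unit_ball_vol (CARD('n)))"
  define L where "L = CARD('n) * (24 * unit_ball_vol (CARD('n)) * 3 ^ CARD('n))"
  define \<mu> where "\<mu> = measure sphere_measure (sphere 0 1 :: (real ^ 'n) set)"
  have KL: "K \<ge> 0" "L \<ge> 0" by (auto simp: K_def L_def)
  have \<mu>: "\<mu> \<ge> 0" by (simp add: \<mu>_def)
  show ?thesis
  proof (rule that[of "2 * K * L + \<mu> * \<mu>"])
    show "2 * K * L + \<mu> * \<mu> \<ge> 0" using KL by simp
    fix y :: "real ^ 'n" and r :: real assume y: "1 \<le> norm y" and r: "0 < r"
    show "(\<integral>\<^sup>+\<omega>. \<integral>\<^sup>+\<nu>. indicator (cball y r) (\<omega> + \<nu>) \<partial>sphere_measure \<partial>sphere_measure)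
      \<le> ennreal ((2 * K * L + \<mu> * \<mu>) * r ^ CARD('n))"
    proof (cases "r \<le> 1")
      case True
      define e where "e = y /\<^sub>R norm y"
      have "y \<noteq> 0" using y by auto
      then have e: "norm e = 1" by (simp add: e_def)
      \<comment> \<open>Obtained by squaring \<open>1 - r \<le> norm (y - \<omega>)\<close> and
        \<open>norm (y - \<omega>) \<le> 1 + r\<close> and solving for
        \<open>\<omega> \<bullet> e\<close>. The resulting slab has width
        \<open>2 * r / norm y\<close>, which is at most \<open>2 * r\<close> because
        \<open>1 \<le> norm y\<close>.\<close>
      define a where "a = ((norm y)\<^sup>2 - 2 * r - r\<^sup>2) / (2 * norm y)"
      let ?H = "{\<omega>. a \<le> \<omega> \<bullet> e \<and> \<omega> \<bullet> e \<le> a + 2 * r}"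
      have inner: "(\<integral>\<^sup>+\<nu>. indicator (cball y r) (\<omega> + \<nu>) \<partial>sphere_measure)
         \<le> ennreal (K * r ^ (CARD('n) - 1)) * indicator (?H \<inter> sphere 0 1) \<omega>"
        if \<omega>: "\<omega> \<in> sphere 0 1" for \<omega>
      proof -
        have eq: "(\<integral>\<^sup>+\<nu>. indicator (cball y r) (\<omega> + \<nu>) \<partial>sphere_measure)
           = emeasure sphere_measure (cball (y - \<omega>) r \<inter> sphere 0 1)"
        proof -
          have "(\<integral>\<^sup>+\<nu>. indicator (cball y r) (\<omega> + \<nu>) \<partial>sphere_measure)
             = (\<integral>\<^sup>+\<nu>. indicator (cball (y - \<omega>) r \<inter> sphere 0 1) \<nu> \<partial>sphere_measure)"
            by (intro nn_integral_cong) (auto simp: indicator_def dist_norm algebra_simps)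
          then show ?thesis by simp
        qed
        show ?thesis
        proof (cases "\<omega> \<in> ?H")
          case True
          then show ?thesis
            using emeasure_sphere_cap_le[OF r \<open>r \<le> 1\<close>, of "y - \<omega>"] \<omega> unfolding eq K_def by simp
        next
          case False
          have "cball (y - \<omega>) r \<inter> sphere 0 1 = {}"
          proof safe
            fix \<nu> assume \<nu>: "\<nu> \<in> cball (y - \<omega>) r" "\<nu> \<in> sphere 0 1"
            have "\<bar>norm (y - \<omega>) - norm \<nu>\<bar> \<le> norm (y - \<omega> - \<nu>)" by (rule norm_triangle_ineq3)
            with \<nu> have n: "1 - r \<le> norm (y - \<omega>)" "norm (y - \<omega>) \<le> 1 + r" by (auto simp: dist_norm)
            have sq: "(1 - r)\<^sup>2 \<le> (norm (y - \<omega>))\<^sup>2" "(norm (y - \<omega>))\<^sup>2 \<le> (1 + r)\<^sup>2"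
              using n \<open>r \<le> 1\<close> by (auto intro!: power_mono)
            have "(norm (y - \<omega>))\<^sup>2 = (norm y)\<^sup>2 + 1 - 2 * (\<omega> \<bullet> y)"
              using \<omega> by (simp add: power2_norm_eq_inner inner_diff_left inner_diff_right inner_commute norm_eq_1)
            moreover have "\<omega> \<bullet> y = norm y * (\<omega> \<bullet> e)" using \<open>y \<noteq> 0\<close> by (simp add: e_def)
            ultimately have "(norm y)\<^sup>2 - 2 * r - r\<^sup>2 \<le> 2 * norm y * (\<omega> \<bullet> e)"
                "2 * norm y * (\<omega> \<bullet> e) \<le> (norm y)\<^sup>2 - 2 * r - r\<^sup>2 + 4 * r"
              using sq by (simp_all add: power2_eq_square algebra_simps)
            moreover have "4 * r \<le> 2 * norm y * (2 * r)" using y r by simp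
            moreover have "0 < norm y" using y by linarith
            ultimately have "\<omega> \<in> ?H" using y by (auto simp: a_def field_simps)
            with False show "\<nu> \<in> {}" by simp
          qed
          then show ?thesis unfolding eq by (simp only: emeasure_empty zero_le)
        qed
      qed
      have "(\<integral>\<^sup>+\<omega>. \<integral>\<^sup>+\<nu>. indicator (cball y r) (\<omega> + \<nu>) \<partial>sphere_measure \<partial>sphere_measure)
        \<le> (\<integral>\<^sup>+\<omega>. ennreal (K * r ^ (CARD('n) - 1)) * indicator (?H \<inter> sphere 0 1) \<omega> \<partial>sphere_measure)"
        by (intro nn_integral_mono inner) simp
      also have "\<dots> = ennreal (K * r ^ (CARD('n) - 1)) * emeasure sphere_measure (?H \<inter> sphere 0 1)"
        by (rule nn_integral_cmult_indicator) measurable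
      also have "\<dots> \<le> ennreal (K * r ^ (CARD('n) - 1)) * ennreal (L * (2 * r))"
        using emeasure_sphere_slab_le[OF dim e, of "2 * r" a] r unfolding L_def by (intro mult_left_mono) auto
      also have "\<dots> = ennreal (2 * K * L * r ^ CARD('n))"
        using KL r power_minus_mult[of "CARD('n)" r] by (simp add: ennreal_mult[symmetric] algebra_simps)
      also have "\<dots> \<le> ennreal ((2 * K * L + \<mu> * \<mu>) * r ^ CARD('n))"
        using KL r by (intro ennreal_leI mult_right_mono) auto
      finally show ?thesis .
    next
      case False
      have "(\<integral>\<^sup>+\<omega>. \<integral>\<^sup>+\<nu>. indicator (cball y r) (\<omega> + \<nu>) \<partial>sphere_measure \<partial>sphere_measure)
        \<le> (\<integral>\<^sup>+\<omega>. \<integral>\<^sup>+\<nu>. 1 \<partial>(sphere_measure :: (real ^ 'n) measure) \<partial>(sphere_measure :: (real ^ 'n) measure))"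
        by (intro nn_integral_mono) (auto simp: indicator_def)
      also have "\<dots> = ennreal (\<mu> * \<mu>)"
        by (simp add: \<mu>_def sphere.emeasure_eq_measure ennreal_mult[symmetric])
      also have "\<dots> \<le> ennreal ((2 * K * L + \<mu> * \<mu>) * r ^ CARD('n))"
      proof (intro ennreal_leI)
        have "1 \<le> r ^ CARD('n)" using False by simp
        then have "\<mu> * \<mu> * 1 \<le> (2 * K * L + \<mu> * \<mu>) * r ^ CARD('n)"
          using KL \<mu> by (intro mult_mono) auto
        then show "\<mu> * \<mu> \<le> (2 * K * L + \<mu> * \<mu>) * r ^ CARD('n)" by simp
      qed
      finally show ?thesis .
    qed
  qed
qed

lemma summable_gaussian_power: "summable (\<lambda>k. exp (- (real k)\<^sup>2 / 2) * real (Suc k) ^ n)"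
proof -
  \<comment> \<open>One term of the exponential series gives
    \<open>x ^ (n + 2) \<le> fact (n + 2) * exp x\<close>; the two extra powers leave a summable 1 /
    x^2. The factor \<open>exp (3 / 2)\<close> is the maximum of exp (- k^2 / 2 + k + 1), attained
    at k = 1.\<close>
  define F :: real where "F = fact (n + 2) * exp (3 / 2)"
  show ?thesis
  proof (rule summable_comparison_test')
    show "summable (\<lambda>k. F * inverse (real (Suc k) ^ 2))"
      using inverse_power_summable[of 2, where 'a = real] by (intro summable_mult) (subst summable_Suc_iff, simp)
    fix k :: nat
    define x where "x = real (Suc k)"
    define g where "g = exp (- (real k)\<^sup>2 / 2)"
    have x: "x > 0" and g: "g > 0" by (simp_all add: x_def g_def)
    have "(\<Sum>i\<in>{n + 2}. x ^ i /\<^sub>R fact i) \<le> (\<Sum>i. x ^ i /\<^sub>R fact i)"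
      by (rule sum_le_suminf[OF summable_exp_generic]) (use x in auto)
    then have "x ^ (n + 2) / fact (n + 2) \<le> exp x"
      by (simp add: exp_def divide_inverse mult.commute del: fact_Suc)
    then have "x ^ (n + 2) \<le> fact (n + 2) * exp x"
      by (subst (asm) pos_divide_le_eq) (simp_all only: fact_gt_zero mult.commute)
    then have "g * x ^ (n + 2) \<le> g * (fact (n + 2) * exp x)"
      using g by (intro mult_left_mono) auto
    also have "\<dots> = fact (n + 2) * exp (- (real k)\<^sup>2 / 2 + x)"
      unfolding g_def exp_add by (rule mult.left_commute)
    also have "\<dots> \<le> F"
    proof -
      have "- (real k)\<^sup>2 / 2 + x \<le> 3 / 2"
        using zero_le_power2[of "real k - 1"] by (simp add: x_def power2_eq_square algebra_simps)
      then show ?thesis unfolding F_def by (intro mult_left_mono) auto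
    qed
    finally have "g * x ^ n * x ^ 2 \<le> F" unfolding power_add mult.assoc .
    then have "g * x ^ n \<le> F / x ^ 2" using x by (simp add: pos_le_divide_eq)
    then have "norm (g * x ^ n) \<le> F * inverse (x ^ 2)" using g x by (simp add: divide_inverse)
    then show "norm (exp (- (real k)\<^sup>2 / 2) * real (Suc k) ^ n) \<le> F * inverse (real (Suc k) ^ 2)"
      unfolding g_def x_def .
  qed
qed

lemma measurable_sphere_fst [measurable]:
  "fst \<in> measurable ((sphere_measure :: (real ^ 'n) measure) \<Otimes>\<^sub>M N) borel"
  by (rule measurable_compose[OF measurable_fst measurable_sphere_ident])

lemma measurable_sphere_snd [measurable]:
  "snd \<in> measurable (N \<Otimes>\<^sub>M (sphere_measure :: (real ^ 'n) measure)) borel"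
  by (rule measurable_compose[OF measurable_snd measurable_sphere_ident])

text \<open>The Gaussian is dominated by a series of multiples of indicators of balls with radius (k
  + 1) \<delta>. The ball estimate contributes ((k + 1) \<delta>)^d, whose power of \<delta> cancels
  the normalization, so the bound is independent of \<delta>.\<close>

lemma sphere_convolution_gaussian_le:
  assumes dim: "CARD('n::finite) \<ge> 3"
  obtains C where "C \<ge> 0" and "\<And>(y :: real ^ 'n) \<delta>. 1 \<le> norm y \<Longrightarrow> 0 < \<delta> \<Longrightarrow>
    (\<integral>\<^sup>+\<omega>. \<integral>\<^sup>+\<nu>. ennreal (exp (- (norm (y - (\<omega> + \<nu>)) / \<delta>)\<^sup>2 / 2) / \<delta> ^ CARD('n))
       \<partial>sphere_measure \<partial>sphere_measure) \<le> ennreal C"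
proof -
  obtain C where C: "C \<ge> 0" and le: "\<And>(y :: real ^ 'n) r. 1 \<le> norm y \<Longrightarrow> 0 < r \<Longrightarrow>
    (\<integral>\<^sup>+\<omega>. \<integral>\<^sup>+\<nu>. indicator (cball y r) (\<omega> + \<nu>) \<partial>sphere_measure \<partial>sphere_measure) \<le> ennreal (C * r ^ CARD('n))"
    using sphere_convolution_ball_le[OF dim] by blast
  let ?a = "\<lambda>k. exp (- (real k)\<^sup>2 / 2) * real (Suc k) ^ CARD('n)"
  show ?thesis
  proof (rule that[of "C * (\<Sum>k. ?a k)"])
    show "0 \<le> C * (\<Sum>k. ?a k)" using C by (intro mult_nonneg_nonneg suminf_nonneg summable_gaussian_power) auto
    fix y :: "real ^ 'n" and \<delta> :: real assume y: "1 \<le> norm y" and \<delta>: "0 < \<delta>"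
    let ?b = "\<lambda>k. exp (- (real k)\<^sup>2 / 2) / \<delta> ^ CARD('n)"
    let ?D = "\<lambda>k. cball y (real (Suc k) * \<delta>)"
    let ?I = "\<lambda>k \<omega>. \<integral>\<^sup>+\<nu>. indicator (?D k) (\<omega> + \<nu>) \<partial>sphere_measure"
    have [measurable]: "?D k \<in> sets borel" for k by simp
    have meas: "?I k \<in> borel_measurable sphere_measure" for k
      by (rule sphere.borel_measurable_nn_integral) measurable
    \<comment> \<open>For \<open>k\<close> the integer part of the scaled distance, the single term
      of index \<open>k\<close> already dominates: \<open>x\<close> lies in its ball, and the
      distance is at least \<open>k\<close> in units of \<open>\<delta>\<close>.\<close>
    have pt: "ennreal (exp (- (norm (y - x) / \<delta>)\<^sup>2 / 2) / \<delta> ^ CARD('n))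
      \<le> (\<Sum>k. ennreal (?b k) * indicator (cball y (real (Suc k) * \<delta>)) x)" for x
    proof -
      define t where "t = norm (y - x) / \<delta>"
      define k where "k = nat \<lfloor>t\<rfloor>"
      have t: "0 \<le> t" using \<delta> by (simp add: t_def)
      then have rk: "real k = of_int \<lfloor>t\<rfloor>" by (simp add: k_def)
      have k: "real k \<le> t" "t < real (Suc k)"
        unfolding of_nat_Suc rk using real_of_int_floor_add_one_gt[of t] by (simp_all only: of_int_floor_le add.commute)
      have "(real k)\<^sup>2 \<le> t\<^sup>2" using k by (intro power_mono) auto
      then have "ennreal (exp (- t\<^sup>2 / 2) / \<delta> ^ CARD('n)) \<le> ennreal (?b k)"
        using \<delta> by (intro ennreal_leI divide_right_mono) auto
      also have "x \<in> cball y (real (Suc k) * \<delta>)"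
        using k(2) \<delta> by (simp add: t_def dist_norm field_simps)
      then have "ennreal (?b k) = (\<Sum>k\<in>{k}. ennreal (?b k) * indicator (cball y (real (Suc k) * \<delta>)) x)"
        by simp
      also have "\<dots> \<le> (\<Sum>k. ennreal (?b k) * indicator (cball y (real (Suc k) * \<delta>)) x)"
        by (rule sum_le_suminf) auto
      finally show ?thesis by (simp add: t_def)
    qed
    have "(\<integral>\<^sup>+\<omega>. \<integral>\<^sup>+\<nu>. ennreal (exp (- (norm (y - (\<omega> + \<nu>)) / \<delta>)\<^sup>2 / 2) / \<delta> ^ CARD('n))
          \<partial>sphere_measure \<partial>sphere_measure)
      \<le> (\<integral>\<^sup>+\<omega>. \<integral>\<^sup>+\<nu>. (\<Sum>k. ennreal (?b k) * indicator (cball y (real (Suc k) * \<delta>)) (\<omega> + \<nu>))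
          \<partial>sphere_measure \<partial>sphere_measure)"
      by (intro nn_integral_mono pt)
    also have "\<dots> = (\<integral>\<^sup>+\<omega>. (\<Sum>k. ennreal (?b k) * ?I k \<omega>) \<partial>sphere_measure)"
    proof (intro nn_integral_cong)
      fix \<omega> :: "real ^ 'n"
      have "(\<integral>\<^sup>+\<nu>. (\<Sum>k. ennreal (?b k) * indicator (?D k) (\<omega> + \<nu>)) \<partial>sphere_measure)
        = (\<Sum>k. \<integral>\<^sup>+\<nu>. ennreal (?b k) * indicator (?D k) (\<omega> + \<nu>) \<partial>sphere_measure)"
        by (rule nn_integral_suminf) measurable
      also have "\<dots> = (\<Sum>k. ennreal (?b k) * ?I k \<omega>)"
        by (intro suminf_cong nn_integral_cmult) measurable
      finally show "(\<integral>\<^sup>+\<nu>. (\<Sum>k. ennreal (?b k) * indicator (?D k) (\<omega> + \<nu>)) \<partial>sphere_measure)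
        = (\<Sum>k. ennreal (?b k) * ?I k \<omega>)" .
    qed
    also have "\<dots> = (\<Sum>k. \<integral>\<^sup>+\<omega>. ennreal (?b k) * ?I k \<omega> \<partial>sphere_measure)"
      by (rule nn_integral_suminf) (intro borel_measurable_times_ennreal borel_measurable_const meas)
    also have "\<dots> = (\<Sum>k. ennreal (?b k) * (\<integral>\<^sup>+\<omega>. ?I k \<omega> \<partial>sphere_measure))"
      by (intro suminf_cong nn_integral_cmult meas)
    also have "\<dots> \<le> (\<Sum>k. ennreal (C * ?a k))"
    proof (intro suminf_le)
      fix k
      have "ennreal (?b k) * (\<integral>\<^sup>+\<omega>. \<integral>\<^sup>+\<nu>. indicator (cball y (real (Suc k) * \<delta>)) (\<omega> + \<nu>)
          \<partial>sphere_measure \<partial>sphere_measure) \<le> ennreal (?b k) * ennreal (C * (real (Suc k) * \<delta>) ^ CARD('n))"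
        using y \<delta> by (intro mult_left_mono le) auto
      also have "\<dots> = ennreal (?b k * (C * (real (Suc k) * \<delta>) ^ CARD('n)))"
        using C \<delta> by (intro ennreal_mult[symmetric]) auto
      also have "?b k * (C * (real (Suc k) * \<delta>) ^ CARD('n)) = C * ?a k"
        using \<delta> by (simp add: power_mult_distrib field_simps del: of_nat_Suc)
      finally show "ennreal (?b k) * (\<integral>\<^sup>+\<omega>. \<integral>\<^sup>+\<nu>. indicator (cball y (real (Suc k) * \<delta>)) (\<omega> + \<nu>)
          \<partial>sphere_measure \<partial>sphere_measure) \<le> ennreal (C * ?a k)" .
    qed auto
    also have "\<dots> = ennreal (C * (\<Sum>k. ?a k))"
      using C summable_gaussian_power[of "CARD('n)"]
      by (subst suminf_ennreal_eq[where x = "C * (\<Sum>k. ?a k)"]) (auto intro!: sums_mult summable_sums simp del: of_nat_Suc)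
    finally show "(\<integral>\<^sup>+\<omega>. \<integral>\<^sup>+\<nu>. ennreal (exp (- (norm (y - (\<omega> + \<nu>)) / \<delta>)\<^sup>2 / 2) / \<delta> ^ CARD('n))
       \<partial>sphere_measure \<partial>sphere_measure) \<le> ennreal (C * (\<Sum>k. ?a k))" .
  qed
qed

subsection \<open>Gaussian-weighted Fourier integrals\<close>

text \<open>This is the characteristic function of the standard normal distribution after the
  substitution of \<open>\<delta> * x\<close> for \<open>x\<close>.\<close>

lemma gaussian_fourier_real:
  fixes \<delta> t :: real
  assumes \<delta>: "\<delta> > 0"
  shows "integrable lborel (\<lambda>x. complex_of_real (exp (- (\<delta> * x)\<^sup>2 / 2)) * exp (\<i> * complex_of_real (t * x)))" (is ?I)
    and "(\<integral>x. complex_of_real (exp (- (\<delta> * x)\<^sup>2 / 2)) * exp (\<i> * complex_of_real (t * x)) \<partial>lborel)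
      = complex_of_real (sqrt (2 * pi) / \<delta> * exp (- (t / \<delta>)\<^sup>2 / 2))" (is ?V)
proof -
  let ?g = "\<lambda>x. complex_of_real (exp (- x\<^sup>2 / 2)) * exp (\<i> * complex_of_real (t / \<delta> * x))"
  have dens: "complex_of_real (exp (- x\<^sup>2 / 2)) = sqrt (2 * pi) * complex_of_real (std_normal_density x)" for x
    by (simp add: std_normal_density_def)
  have int_std: "integrable lborel (\<lambda>x. std_normal_density x *\<^sub>R (exp (\<i> * complex_of_real (t / \<delta> * x))))"
    using integrable_normal_moment[of 1 0 0] 
    by (rule Bochner_Integration.integrable_bound) (auto simp: norm_exp_i_times)
  have "(\<integral>x. std_normal_density x *\<^sub>R iexp (t / \<delta> * x) \<partial>lborel) = char std_normal_distribution (t / \<delta>)"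
    unfolding char_def by (subst integral_density) (auto simp: normal_density_nonneg)
  then have val_std: "(\<integral>x. std_normal_density x *\<^sub>R exp (\<i> * complex_of_real (t / \<delta> * x)) \<partial>lborel)
     = complex_of_real (exp (- (t / \<delta>)\<^sup>2 / 2))"
    by (simp add: char_std_normal_distribution)
  have g: "?g = (\<lambda>x. complex_of_real (sqrt (2 * pi)) * (std_normal_density x *\<^sub>R exp (\<i> * complex_of_real (t / \<delta> * x))))"
    unfolding dens by (simp add: scaleR_conv_of_real mult.assoc)
  have 1: "integrable lborel ?g" unfolding g by (intro integrable_mult_right int_std)
  have 2: "integral\<^sup>L lborel ?g = complex_of_real (sqrt (2 * pi) * exp (- (t / \<delta>)\<^sup>2 / 2))"
    unfolding g integral_mult_right_zero val_std by simp
  have comp: "?g (0 + \<delta> * x) = complex_of_real (exp (- (\<delta> * x)\<^sup>2 / 2)) * exp (\<i> * complex_of_real (t * x))" for x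
    using \<delta> by simp
  have "has_bochner_integral lborel ?g (complex_of_real (sqrt (2 * pi) * exp (- (t / \<delta>)\<^sup>2 / 2)))"
    using 1 2 by (simp add: has_bochner_integral_iff)
  then have "has_bochner_integral lborel (\<lambda>x. ?g (0 + \<delta> * x)) (complex_of_real (sqrt (2 * pi) * exp (- (t / \<delta>)\<^sup>2 / 2)) /\<^sub>R \<bar>\<delta>\<bar>)"
    using \<delta> by (subst (asm) lborel_has_bochner_integral_real_affine_iff[where c = \<delta> and t = 0]) auto
  then have *: "has_bochner_integral lborel (\<lambda>x. complex_of_real (exp (- (\<delta> * x)\<^sup>2 / 2)) * exp (\<i> * complex_of_real (t * x)))
     (complex_of_real (sqrt (2 * pi) / \<delta> * exp (- (t / \<delta>)\<^sup>2 / 2)))"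
    unfolding comp using \<delta> by (simp add: scaleR_conv_of_real field_simps)
  show ?I ?V using * by (auto simp: has_bochner_integral_iff)
qed

text \<open>Weight and exponential both factor over an orthonormal basis, and Lebesgue measure is
  the image of a product of one-dimensional ones, so the one-dimensional formulas multiply.\<close>

lemma gaussian_fourier:
  fixes z :: "'a::euclidean_space" and \<delta> :: real
  assumes \<delta>: "\<delta> > 0"
  shows "integrable lborel (\<lambda>x::'a. exp (- (\<delta> * norm x)\<^sup>2 / 2))" (is ?I)
    and "(\<integral>x. complex_of_real (exp (- (\<delta> * norm x)\<^sup>2 / 2)) * exp (\<i> * complex_of_real (z \<bullet> x)) \<partial>lborel)
      = complex_of_real ((sqrt (2 * pi) / \<delta>) ^ DIM('a) * exp (- (norm z / \<delta>)\<^sup>2 / 2))" (is ?V)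
proof -
  let ?B = "Basis :: 'a set"
  interpret product_sigma_finite "\<lambda>_::'a. lborel :: real measure" ..
  let ?f = "\<lambda>z b x. complex_of_real (exp (- (\<delta> * x)\<^sup>2 / 2)) * exp (\<i> * complex_of_real ((z \<bullet> b) * x))"
  have nn: "(norm y)\<^sup>2 = (\<Sum>b\<in>?B. (y \<bullet> b)\<^sup>2)" for y :: 'a
    by (subst power2_norm_eq_inner, subst euclidean_inner) (simp add: power2_eq_square)
  have prod: "complex_of_real (exp (- (\<delta> * norm y)\<^sup>2 / 2)) * exp (\<i> * complex_of_real (z \<bullet> y))
     = (\<Prod>b\<in>?B. ?f z b (y \<bullet> b))" for y z :: 'a
  proof -
    have "- (\<delta> * norm y)\<^sup>2 / 2 = (\<Sum>b\<in>?B. - (\<delta> * (y \<bullet> b))\<^sup>2 / 2)"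
      by (simp add: power_mult_distrib nn sum_distrib_left sum_divide_distrib sum_negf)
    moreover have "\<i> * complex_of_real (z \<bullet> y) = (\<Sum>b\<in>?B. \<i> * complex_of_real ((z \<bullet> b) * (y \<bullet> b)))"
      by (simp add: euclidean_inner[of z y] sum_distrib_left)
    ultimately show ?thesis
      by (simp only: exp_sum[OF finite_Basis] prod.distrib of_real_prod)
  qed
  have comp: "(\<Sum>b\<in>?B. f b *\<^sub>R b) \<bullet> b = f b" if "b \<in> ?B" for f b
    using that by (simp add: inner_sum_left inner_Basis if_distrib cong: if_cong)
  have *: "has_bochner_integral lborel (\<lambda>x::'a. complex_of_real (exp (- (\<delta> * norm x)\<^sup>2 / 2)) * exp (\<i> * complex_of_real (z \<bullet> x)))
    (complex_of_real ((sqrt (2 * pi) / \<delta>) ^ DIM('a) * exp (- (norm z / \<delta>)\<^sup>2 / 2)))" for z :: 'a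
  proof -
    have m: "(\<lambda>f. \<Sum>b\<in>?B. f b *\<^sub>R b) \<in> measurable (\<Pi>\<^sub>M b\<in>?B. lborel) borel"
      by measurable
    have "has_bochner_integral (\<Pi>\<^sub>M b\<in>?B. lborel) (\<lambda>f. \<Prod>b\<in>?B. ?f z b (f b)) (\<Prod>b\<in>?B. integral\<^sup>L lborel (?f z b))"
      unfolding has_bochner_integral_iff
      using product_integral_prod[of ?B "?f z"] product_integrable_prod[of ?B "?f z"] gaussian_fourier_real(1)[OF \<delta>] by auto
    moreover have "(\<Prod>b\<in>?B. integral\<^sup>L lborel (?f z b)) 
       = (\<Prod>b\<in>?B. complex_of_real (sqrt (2 * pi) / \<delta> * exp (- ((z \<bullet> b) / \<delta>)\<^sup>2 / 2)))"
      by (intro prod.cong refl gaussian_fourier_real(2)[OF \<delta>])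
    moreover have "\<dots> = complex_of_real ((sqrt (2 * pi) / \<delta>) ^ DIM('a) * exp (- (norm z / \<delta>)\<^sup>2 / 2))"
    proof -
      have "- (norm z / \<delta>)\<^sup>2 / 2 = (\<Sum>b\<in>?B. - ((z \<bullet> b) / \<delta>)\<^sup>2 / 2)"
        by (simp add: power_divide nn sum_divide_distrib sum_negf)
      then show ?thesis by (simp only: exp_sum[OF finite_Basis] prod.distrib prod_constant flip: of_real_prod)
    qed
    moreover have "(\<lambda>f. \<Prod>b\<in>?B. ?f z b (f b)) = (\<lambda>f. \<Prod>b\<in>?B. ?f z b ((\<Sum>b\<in>?B. f b *\<^sub>R b) \<bullet> b))"
      by (intro ext prod.cong refl) (simp only: comp)
    ultimately have "has_bochner_integral (\<Pi>\<^sub>M b\<in>?B. lborel) 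
       (\<lambda>f. (\<lambda>x. \<Prod>b\<in>?B. ?f z b (x \<bullet> b)) (\<Sum>b\<in>?B. f b *\<^sub>R b))
       (complex_of_real ((sqrt (2 * pi) / \<delta>) ^ DIM('a) * exp (- (norm z / \<delta>)\<^sup>2 / 2)))"
      by simp
    then show ?thesis unfolding prod
      by (subst lborel_eq) (rule has_bochner_integral_distr[OF _ m]; simp)
  qed
  have "integrable lborel (\<lambda>x::'a. complex_of_real (exp (- (\<delta> * norm x)\<^sup>2 / 2)))"
    using *[of 0] by (simp add: has_bochner_integral_iff)
  then show ?I using integrable_norm by fastforce
  show ?V using *[of z] by (simp only: has_bochner_integral_iff)
qed

lemma (in pair_sigma_finite)
  fixes f :: "'a \<Rightarrow> 'c::{real_normed_field,banach,second_countable_topology}"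
  assumes f: "integrable M1 f" and g: "integrable M2 g"
  shows integrable_mult_product: "integrable (M1 \<Otimes>\<^sub>M M2) (\<lambda>z. f (fst z) * g (snd z))" (is ?I)
    and integral_mult_product:
      "(\<integral>z. f (fst z) * g (snd z) \<partial>(M1 \<Otimes>\<^sub>M M2)) = (\<integral>x. f x \<partial>M1) * (\<integral>y. g y \<partial>M2)"
proof -
  note [measurable] = borel_measurable_integrable[OF f] borel_measurable_integrable[OF g]
  show I: ?I
  proof (rule Fubini_integrable)
    show "integrable M1 (\<lambda>x. \<integral>y. norm (f (fst (x, y)) * g (snd (x, y))) \<partial>M2)"
      using f by (simp add: norm_mult)
    show "AE x in M1. integrable M2 (\<lambda>y. f (fst (x, y)) * g (snd (x, y)))"
      using g by simp
  qed measurable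
  show "(\<integral>z. f (fst z) * g (snd z) \<partial>(M1 \<Otimes>\<^sub>M M2)) = (\<integral>x. f x \<partial>M1) * (\<integral>y. g y \<partial>M2)"
    using integral_fst'[OF I] by simp
qed

lemma norm_exp_i [simp]: "cmod (exp (\<i> * complex_of_real t)) = 1"
  by (simp add: norm_exp_i_times)

section \<open>Schur's test for Fourier integrals\<close>

text \<open>Write the squared modulus as a double integral and integrate in \<open>x\<close> first:
  the Gaussian turns the oscillation into a positive kernel in \<open>s p - s q\<close>.
  \<open>M\<close> and \<open>s\<close> are abstract because the application takes two copies of the
  sphere for \<open>M\<close> and addition for \<open>s\<close>.\<close>

lemma weighted_fourier_square_le:
  fixes M :: "'b measure" and s :: "'b \<Rightarrow> 'a::euclidean_space" and h :: "'b \<Rightarrow> complex"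
  assumes M: "sigma_finite_measure M" and h: "integrable M h"
    and s [measurable]: "s \<in> borel_measurable M" and \<delta>: "\<delta> > 0"
  shows "(\<integral>\<^sup>+x. ennreal ((cmod (\<integral>p. h p * exp (\<i> * complex_of_real (s p \<bullet> x)) \<partial>M))\<^sup>2 * exp (- (\<delta> * norm x)\<^sup>2 / 2)) \<partial>lborel)
    \<le> (\<integral>\<^sup>+p. \<integral>\<^sup>+q. ennreal (cmod (h p) * cmod (h q) * ((sqrt (2 * pi) / \<delta>) ^ DIM('a) * exp (- (norm (s p - s q) / \<delta>)\<^sup>2 / 2))) \<partial>M \<partial>M)"
proof -
  interpret sigma_finite_measure M by fact
  interpret MM: pair_sigma_finite M M ..
  let ?N = "M \<Otimes>\<^sub>M M"
  interpret LN: pair_sigma_finite "lborel :: 'a measure" ?N ..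
  note [measurable] = borel_measurable_integrable[OF h]
  let ?e = "\<lambda>t. exp (\<i> * complex_of_real t)"
  let ?F = "\<lambda>x. \<integral>p. h p * ?e (s p \<bullet> x) \<partial>M"
  let ?H = "\<lambda>r. h (fst r) * cnj (h (snd r))"
  let ?S = "\<lambda>r. s (fst r) - s (snd r)"
  let ?w = "\<lambda>x::'a. exp (- (\<delta> * norm x)\<^sup>2 / 2)"
  let ?G = "\<lambda>z::'a. (sqrt (2 * pi) / \<delta>) ^ DIM('a) * exp (- (norm z / \<delta>)\<^sup>2 / 2)"
  have [measurable]: "cnj \<in> borel_measurable borel"
    by (intro borel_measurable_continuous_onI continuous_intros)
  have eh: "integrable M (\<lambda>p. h p * ?e (s p \<bullet> x))" for x
    by (rule Bochner_Integration.integrable_bound[OF h]) (auto simp: norm_mult)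
  have H: "integrable ?N ?H"
    by (rule MM.integrable_mult_product[OF h]) (simp add: h)
  have sq: "?F x * cnj (?F x) = (\<integral>r. ?H r * ?e (?S r \<bullet> x) \<partial>?N)" for x
  proof -
    have "?F x * cnj (?F x) = ?F x * (\<integral>p. cnj (h p * ?e (s p \<bullet> x)) \<partial>M)"
      by (simp only: Bochner_Integration.integral_cnj)
    also have "\<dots> = (\<integral>r. (h (fst r) * ?e (s (fst r) \<bullet> x)) * cnj (h (snd r) * ?e (s (snd r) \<bullet> x)) \<partial>?N)"
      by (rule MM.integral_mult_product[symmetric, OF eh]) (intro integrable_cnj eh)
    also have "\<dots> = (\<integral>r. ?H r * ?e (?S r \<bullet> x) \<partial>?N)"
    proof (intro Bochner_Integration.integral_cong refl)
      fix r
      have "?e (?S r \<bullet> x) = ?e (s (fst r) \<bullet> x) * cnj (?e (s (snd r) \<bullet> x))"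
        by (simp add: exp_cnj inner_diff_left exp_add[symmetric] algebra_simps)
      then show "(h (fst r) * ?e (s (fst r) \<bullet> x)) * cnj (h (snd r) * ?e (s (snd r) \<bullet> x)) = ?H r * ?e (?S r \<bullet> x)"
        by simp
    qed
    finally show ?thesis .
  qed
  have w: "integrable lborel (\<lambda>x. complex_of_real (?w x))"
    using gaussian_fourier(1)[OF \<delta>] by (rule integrable_of_real)
  have K: "integrable (lborel \<Otimes>\<^sub>M ?N) (\<lambda>(x, r). complex_of_real (?w x) * (?H r * ?e (?S r \<bullet> x)))"
    by (rule Bochner_Integration.integrable_bound[OF LN.integrable_mult_product[OF w H]], measurable)
       (auto simp: norm_mult)
  have eq: "complex_of_real ((cmod (?F x))\<^sup>2 * ?w x) = (\<integral>r. complex_of_real (?w x) * (?H r * ?e (?S r \<bullet> x)) \<partial>?N)" for x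
    using sq[of x] by (simp only: integral_mult_right_zero of_real_mult complex_norm_square mult.commute)
  have "integrable lborel (\<lambda>x. complex_of_real ((cmod (?F x))\<^sup>2 * ?w x))"
    unfolding eq using LN.integrable_fst[OF K] .
  then have int: "integrable lborel (\<lambda>x. (cmod (?F x))\<^sup>2 * ?w x)"
    using integrable_Re by fastforce
  have "complex_of_real (\<integral>x. (cmod (?F x))\<^sup>2 * ?w x \<partial>lborel) = (\<integral>x. complex_of_real ((cmod (?F x))\<^sup>2 * ?w x) \<partial>lborel)"
    by (rule integral_complex_of_real[symmetric])
  also have "\<dots> = (\<integral>x. \<integral>r. complex_of_real (?w x) * (?H r * ?e (?S r \<bullet> x)) \<partial>?N \<partial>lborel)"
    by (simp only: eq)
  also have "\<dots> = (\<integral>r. \<integral>x. complex_of_real (?w x) * (?H r * ?e (?S r \<bullet> x)) \<partial>lborel \<partial>?N)"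
    by (rule LN.Fubini_integral[symmetric, OF K])
  also have "\<dots> = (\<integral>r. ?H r * complex_of_real (?G (?S r)) \<partial>?N)"
  proof (intro Bochner_Integration.integral_cong refl)
    fix r
    have "(\<integral>x. complex_of_real (?w x) * (?H r * ?e (?S r \<bullet> x)) \<partial>lborel)
       = (\<integral>x. ?H r * (complex_of_real (?w x) * ?e (?S r \<bullet> x)) \<partial>lborel)"
      by (simp only: mult.left_commute)
    also have "\<dots> = ?H r * complex_of_real (?G (?S r))"
      by (simp only: integral_mult_right_zero gaussian_fourier(2)[OF \<delta>])
    finally show "(\<integral>x. complex_of_real (?w x) * (?H r * ?e (?S r \<bullet> x)) \<partial>lborel) = ?H r * complex_of_real (?G (?S r))" .
  qed
  finally have val: "complex_of_real (\<integral>x. (cmod (?F x))\<^sup>2 * ?w x \<partial>lborel) = (\<integral>r. ?H r * complex_of_real (?G (?S r)) \<partial>?N)" .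
  have nn: "0 \<le> (\<integral>x. (cmod (?F x))\<^sup>2 * ?w x \<partial>lborel)" by simp
  have Gnn: "?G z \<ge> 0" for z using \<delta> by simp
  have "(\<integral>\<^sup>+x. ennreal ((cmod (?F x))\<^sup>2 * ?w x) \<partial>lborel) = ennreal (\<integral>x. (cmod (?F x))\<^sup>2 * ?w x \<partial>lborel)"
    by (rule nn_integral_eq_integral[OF int]) simp
  also have "\<dots> = ennreal (cmod (\<integral>r. ?H r * complex_of_real (?G (?S r)) \<partial>?N))"
    unfolding val[symmetric] norm_of_real using nn by simp
  also have "\<dots> \<le> (\<integral>\<^sup>+r. ennreal (cmod (?H r * complex_of_real (?G (?S r)))) \<partial>?N)"
  \<comment> \<open>The Bochner integral of a non-integrable function is 0 by default, so the norm
    bound holds in that case too.\<close>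
  proof (cases "integrable ?N (\<lambda>r. ?H r * complex_of_real (?G (?S r)))")
    case True then show ?thesis by (rule integral_norm_bound_ennreal)
  next
    case False
    from Bochner_Integration.not_integrable_integral_eq[OF this] show ?thesis
      by (simp only: norm_zero ennreal_0 zero_le)
  qed
  also have "\<dots> = (\<integral>\<^sup>+r. ennreal (cmod (h (fst r)) * cmod (h (snd r)) * ?G (?S r)) \<partial>?N)"
    by (intro nn_integral_cong) (use Gnn in \<open>simp only: norm_mult complex_mod_cnj norm_of_real abs_of_nonneg\<close>)
  also have "\<dots> = (\<integral>\<^sup>+p. \<integral>\<^sup>+q. ennreal (cmod (h p) * cmod (h q) * ?G (s p - s q)) \<partial>M \<partial>M)"
    by (subst nn_integral_fst[symmetric]) simp_all
  finally show ?thesis .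
qed

text \<open>\<open>cmod (h p) * cmod (h q)\<close> is at most half the sum of the squares, and the
  two halves agree because the kernel is symmetric; what remains is a row integral. Rows are
  controlled only where \<open>h\<close> is nonzero, which is how the support of \<open>f\<close>
  will enter.\<close>

lemma weighted_fourier_square_schur:
  fixes M :: "'b measure" and s :: "'b \<Rightarrow> 'a::euclidean_space" and h :: "'b \<Rightarrow> complex"
  assumes M: "sigma_finite_measure M" and h: "integrable M h"
    and s [measurable]: "s \<in> borel_measurable M" and \<delta>: "\<delta> > 0"
    and C: "\<And>p. p \<in> space M \<Longrightarrow> h p \<noteq> 0 \<Longrightarrow>
      (\<integral>\<^sup>+q. ennreal (exp (- (norm (s p - s q) / \<delta>)\<^sup>2 / 2) / \<delta> ^ DIM('a)) \<partial>M) \<le> C"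
  shows "(\<integral>\<^sup>+x. ennreal ((cmod (\<integral>p. h p * exp (\<i> * complex_of_real (s p \<bullet> x)) \<partial>M))\<^sup>2 * exp (- (\<delta> * norm x)\<^sup>2 / 2)) \<partial>lborel)
    \<le> ennreal (sqrt (2 * pi) ^ DIM('a)) * C * (\<integral>\<^sup>+p. ennreal ((cmod (h p))\<^sup>2) \<partial>M)"
proof -
  interpret sigma_finite_measure M by fact
  interpret MM: pair_sigma_finite M M ..
  note [measurable] = borel_measurable_integrable[OF h]
  let ?g = "\<lambda>p q. ennreal (exp (- (norm (s p - s q) / \<delta>)\<^sup>2 / 2) / \<delta> ^ DIM('a))"
  let ?c = "ennreal (sqrt (2 * pi) ^ DIM('a) / 2)"
  let ?k = "\<lambda>p q. ennreal ((cmod (h p))\<^sup>2) * ?g p q"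
  have half: "(\<integral>\<^sup>+p. \<integral>\<^sup>+q. ?k p q \<partial>M \<partial>M) \<le> C * (\<integral>\<^sup>+p. ennreal ((cmod (h p))\<^sup>2) \<partial>M)"
  proof -
    have "(\<integral>\<^sup>+p. \<integral>\<^sup>+q. ?k p q \<partial>M \<partial>M) = (\<integral>\<^sup>+p. ennreal ((cmod (h p))\<^sup>2) * (\<integral>\<^sup>+q. ?g p q \<partial>M) \<partial>M)"
      by (intro nn_integral_cong nn_integral_cmult) measurable
    also have "\<dots> \<le> (\<integral>\<^sup>+p. C * ennreal ((cmod (h p))\<^sup>2) \<partial>M)"
    proof (intro nn_integral_mono)
      fix p assume p: "p \<in> space M"
      show "ennreal ((cmod (h p))\<^sup>2) * (\<integral>\<^sup>+q. ?g p q \<partial>M) \<le> C * ennreal ((cmod (h p))\<^sup>2)"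
      proof (cases "h p = 0")
        case False
        then show ?thesis using C[OF p] by (subst mult.commute) (intro mult_right_mono, auto)
      qed simp
    qed
    also have "\<dots> = C * (\<integral>\<^sup>+p. ennreal ((cmod (h p))\<^sup>2) \<partial>M)"
      by (intro nn_integral_cmult) measurable
    finally show ?thesis .
  qed
  have swap: "(\<integral>\<^sup>+p. \<integral>\<^sup>+q. ?k q p \<partial>M \<partial>M) = (\<integral>\<^sup>+p. \<integral>\<^sup>+q. ?k p q \<partial>M \<partial>M)"
    by (rule MM.Fubini') measurable
  have "(\<integral>\<^sup>+p. \<integral>\<^sup>+q. ennreal (cmod (h p) * cmod (h q) * ((sqrt (2 * pi) / \<delta>) ^ DIM('a) * exp (- (norm (s p - s q) / \<delta>)\<^sup>2 / 2))) \<partial>M \<partial>M)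
    \<le> (\<integral>\<^sup>+p. \<integral>\<^sup>+q. ?c * (?k p q + ?k q p) \<partial>M \<partial>M)"
  proof (intro nn_integral_mono)
    fix p q
    define A where "A = sqrt (2 * pi) ^ DIM('a)"
    define D where "D = exp (- (norm (s p - s q) / \<delta>)\<^sup>2 / 2) / \<delta> ^ DIM('a)"
    have AD: "A \<ge> 0" "D \<ge> 0" using \<delta> by (simp_all add: A_def D_def)
    have sym: "norm (s q - s p) = norm (s p - s q)" by (rule norm_minus_commute)
    have "cmod (h p) * cmod (h q) \<le> ((cmod (h p))\<^sup>2 + (cmod (h q))\<^sup>2) / 2"
      using sum_squares_bound[of "cmod (h p)" "cmod (h q)"] by simp
    then have "cmod (h p) * cmod (h q) * (A * D) \<le> ((cmod (h p))\<^sup>2 + (cmod (h q))\<^sup>2) / 2 * (A * D)"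
      using AD by (intro mult_right_mono) auto
    also have "\<dots> = A / 2 * ((cmod (h p))\<^sup>2 * D + (cmod (h q))\<^sup>2 * D)" by (simp add: algebra_simps)
    finally have "ennreal (cmod (h p) * cmod (h q) * (A * D)) \<le> ennreal (A / 2 * ((cmod (h p))\<^sup>2 * D + (cmod (h q))\<^sup>2 * D))"
      by (rule ennreal_leI)
    also have "\<dots> = ennreal (A / 2) * (ennreal ((cmod (h p))\<^sup>2) * ennreal D + ennreal ((cmod (h q))\<^sup>2) * ennreal D)"
    proof -
      have "ennreal (A / 2 * ((cmod (h p))\<^sup>2 * D + (cmod (h q))\<^sup>2 * D))
        = ennreal (A / 2) * ennreal ((cmod (h p))\<^sup>2 * D + (cmod (h q))\<^sup>2 * D)"
        using AD by (intro ennreal_mult) auto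
      also have "ennreal ((cmod (h p))\<^sup>2 * D + (cmod (h q))\<^sup>2 * D)
        = ennreal ((cmod (h p))\<^sup>2) * ennreal D + ennreal ((cmod (h q))\<^sup>2) * ennreal D"
        using AD by (simp only: ennreal_mult ennreal_plus mult_nonneg_nonneg zero_le_power2)
      finally show ?thesis .
    qed
    also have "A * D = (sqrt (2 * pi) / \<delta>) ^ DIM('a) * exp (- (norm (s p - s q) / \<delta>)\<^sup>2 / 2)"
      by (simp add: A_def D_def power_divide)
    finally show "ennreal (cmod (h p) * cmod (h q) * ((sqrt (2 * pi) / \<delta>) ^ DIM('a) * exp (- (norm (s p - s q) / \<delta>)\<^sup>2 / 2)))
      \<le> ?c * (?k p q + ?k q p)" unfolding sym A_def D_def .
  qed
  also have "\<dots> = ?c * ((\<integral>\<^sup>+p. \<integral>\<^sup>+q. ?k p q \<partial>M \<partial>M) + (\<integral>\<^sup>+p. \<integral>\<^sup>+q. ?k q p \<partial>M \<partial>M))"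
  proof -
    have "(\<integral>\<^sup>+p. \<integral>\<^sup>+q. ?c * (?k p q + ?k q p) \<partial>M \<partial>M)
      = (\<integral>\<^sup>+p. ?c * ((\<integral>\<^sup>+q. ?k p q \<partial>M) + (\<integral>\<^sup>+q. ?k q p \<partial>M)) \<partial>M)"
      by (intro nn_integral_cong, subst nn_integral_cmult, measurable, subst nn_integral_add) measurable
    also have "\<dots> = ?c * (\<integral>\<^sup>+p. (\<integral>\<^sup>+q. ?k p q \<partial>M) + (\<integral>\<^sup>+q. ?k q p \<partial>M) \<partial>M)"
      by (intro nn_integral_cmult) measurable
    also have "(\<integral>\<^sup>+p. (\<integral>\<^sup>+q. ?k p q \<partial>M) + (\<integral>\<^sup>+q. ?k q p \<partial>M) \<partial>M)
       = (\<integral>\<^sup>+p. \<integral>\<^sup>+q. ?k p q \<partial>M \<partial>M) + (\<integral>\<^sup>+p. \<integral>\<^sup>+q. ?k q p \<partial>M \<partial>M)"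
      by (intro nn_integral_add) measurable
    finally show ?thesis .
  qed
  also have "\<dots> \<le> ?c * (C * (\<integral>\<^sup>+p. ennreal ((cmod (h p))\<^sup>2) \<partial>M) + C * (\<integral>\<^sup>+p. ennreal ((cmod (h p))\<^sup>2) \<partial>M))"
    unfolding swap by (intro mult_left_mono add_mono half) auto
  also have "\<dots> = ennreal (sqrt (2 * pi) ^ DIM('a)) * C * (\<integral>\<^sup>+p. ennreal ((cmod (h p))\<^sup>2) \<partial>M)"
  proof -
    have "?c * (X + X) = ennreal (sqrt (2 * pi) ^ DIM('a)) * X" for X
    proof -
      have "?c + ?c = ennreal (sqrt (2 * pi) ^ DIM('a))" by (subst ennreal_plus[symmetric]) auto
      then show ?thesis by (metis distrib_left distrib_right)
    qed
    then show ?thesis by (simp add: mult.assoc)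
  qed
  finally show ?thesis
    by (rule order_trans[OF weighted_fourier_square_le[OF M h s \<delta>]])
qed

subsection \<open>The extension inequality\<close>

abbreviation gauss_weight :: "real \<Rightarrow> 'a::euclidean_space \<Rightarrow> real" where
  "gauss_weight \<delta> x \<equiv> exp (- (\<delta> * norm x)\<^sup>2 / 2)"

lemma borel_measurable_fourier_extension:
  fixes f :: "real ^ 'n \<Rightarrow> complex"
  assumes [measurable]: "f \<in> borel_measurable sphere_measure"
  shows "fourier_extension f \<in> borel_measurable borel"
proof -
  have "(\<lambda>x. \<integral>\<omega>. f \<omega> * exp (\<i> * complex_of_real (\<omega> \<bullet> x)) \<partial>sphere_measure) \<in> borel_measurable borel"
    by (rule sphere.borel_measurable_lebesgue_integral) measurable
  then show ?thesis by (simp add: fourier_extension_def[abs_def])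
qed

lemma L2_sphere_measurable [measurable_dest]: "f \<in> L2_sphere \<Longrightarrow> f \<in> borel_measurable sphere_measure"
  by (simp add: L2_sphere_def)

lemma L2_sphere_square_integrable: "f \<in> L2_sphere \<Longrightarrow> integrable sphere_measure (\<lambda>\<omega>. (cmod (f \<omega>))\<^sup>2)"
  by (simp add: L2_sphere_def)

lemma L2_sphere_integrable:
  fixes f :: "real ^ 'n \<Rightarrow> complex"
  assumes f: "f \<in> L2_sphere"
  shows "integrable sphere_measure f"
proof (rule Bochner_Integration.integrable_bound)
  show "integrable sphere_measure (\<lambda>\<omega>. 1 + (cmod (f \<omega>))\<^sup>2)"
    using L2_sphere_square_integrable[OF f] by simp
  show "f \<in> borel_measurable sphere_measure" using f by measurable
  show "AE \<omega> in sphere_measure. norm (f \<omega>) \<le> norm (1 + (cmod (f \<omega>))\<^sup>2)"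
  proof (intro AE_I2)
    fix \<omega>
    show "norm (f \<omega>) \<le> norm (1 + (cmod (f \<omega>))\<^sup>2)"
      using sum_squares_bound[of 1 "cmod (f \<omega>)"] norm_ge_zero[of "f \<omega>"]
      unfolding real_norm_def one_power2 by linarith
  qed
qed

lemma L2_sphere_norm_power4: "L2_sphere_norm f ^ 4 = (\<integral>\<omega>. (cmod (f \<omega>))\<^sup>2 \<partial>sphere_measure)\<^sup>2"
proof -
  have "L2_sphere_norm f ^ 4 = ((L2_sphere_norm f)\<^sup>2)\<^sup>2" by simp
  also have "(L2_sphere_norm f)\<^sup>2 = (\<integral>\<omega>. (cmod (f \<omega>))\<^sup>2 \<partial>sphere_measure)"
    by (simp add: L2_sphere_norm_def)
  finally show ?thesis .
qed

lemma integrable_fourier_extension: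
  fixes f :: "real ^ 'n \<Rightarrow> complex"
  assumes f: "integrable sphere_measure f"
  shows "integrable sphere_measure (\<lambda>\<omega>. f \<omega> * exp (\<i> * complex_of_real (\<omega> \<bullet> x)))"
proof (rule Bochner_Integration.integrable_bound[OF f])
  note [measurable] = borel_measurable_integrable[OF f]
  show "(\<lambda>\<omega>. f \<omega> * exp (\<i> * complex_of_real (\<omega> \<bullet> x))) \<in> borel_measurable sphere_measure"
    by measurable
qed (auto simp: norm_mult)

lemma fourier_extension_add:
  fixes f g :: "real ^ 'n \<Rightarrow> complex"
  assumes "integrable sphere_measure f" "integrable sphere_measure g"
  shows "fourier_extension (\<lambda>\<omega>. f \<omega> + g \<omega>) x = fourier_extension f x + fourier_extension g x"
  unfolding fourier_extension_def distrib_right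
  by (intro Bochner_Integration.integral_add integrable_fourier_extension assms)

lemma fourier_extension_cmult:
  "fourier_extension (\<lambda>\<omega>. c * f \<omega>) x = c * fourier_extension f x"
  unfolding fourier_extension_def by (simp only: mult.assoc integral_mult_right_zero)

text \<open>\<open>(fourier_extension f x)\<^sup>2\<close> is a Fourier integral of the tensor
  square of \<open>f\<close> with frequency \<omega> + \<nu>, so the fourth power falls under
  Schur's test, and the squared L^2 norm of the tensor square is
  \<open>L2_sphere_norm f ^ 4\<close>. Two points within 1/2 of a unit vector \<open>c\<close> have
  a sum of norm at least 2 - 1 = 1, where the convolution estimate is available.\<close>

lemma fourier_extension_local_bound:
  assumes dim: "CARD('n::finite) \<ge> 3"
  obtains K where "K \<ge> 0" and
    "\<And>c (f :: real ^ 'n \<Rightarrow> complex) \<delta>. norm c = 1 \<Longrightarrow> f \<in> L2_sphere \<Longrightarrow> (\<And>\<omega>. \<omega> \<notin> ball c (1/2) \<Longrightarrow> f \<omega> = 0) \<Longrightarrow>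
      \<delta> > 0 \<Longrightarrow> (\<integral>\<^sup>+x. ennreal (cmod (fourier_extension f x) ^ 4 * gauss_weight \<delta> x) \<partial>lborel)
        \<le> ennreal (K * L2_sphere_norm f ^ 4)"
proof -
  obtain C where C0: "C \<ge> 0" and C: "\<And>(y :: real ^ 'n) \<delta>. 1 \<le> norm y \<Longrightarrow> 0 < \<delta> \<Longrightarrow>
    (\<integral>\<^sup>+\<omega>. \<integral>\<^sup>+\<nu>. ennreal (exp (- (norm (y - (\<omega> + \<nu>)) / \<delta>)\<^sup>2 / 2) / \<delta> ^ CARD('n))
       \<partial>sphere_measure \<partial>sphere_measure) \<le> ennreal C"
    using sphere_convolution_gaussian_le[OF dim] by blast
  let ?K = "sqrt (2 * pi) ^ CARD('n) * C"
  show ?thesis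
  proof (rule that[of ?K])
    show "?K \<ge> 0" using C0 by simp
    fix c :: "real ^ 'n" and f :: "real ^ 'n \<Rightarrow> complex" and \<delta> :: real
    assume c: "norm c = 1" and f: "f \<in> L2_sphere" and supp: "\<And>\<omega>. \<omega> \<notin> ball c (1/2) \<Longrightarrow> f \<omega> = 0" and \<delta>: "\<delta> > 0"
    let ?\<sigma> = "sphere_measure :: (real ^ 'n) measure"
    let ?h = "\<lambda>p. f (fst p) * f (snd p)"
    let ?s = "\<lambda>p::(real ^ 'n) \<times> (real ^ 'n). fst p + snd p"
    note fi = L2_sphere_integrable[OF f]
    note f2 = L2_sphere_square_integrable[OF f]
    note [measurable] = L2_sphere_measurable[OF f]
    have sq: "(fourier_extension f x)\<^sup>2 = (\<integral>p. ?h p * exp (\<i> * complex_of_real (?s p \<bullet> x)) \<partial>(?\<sigma> \<Otimes>\<^sub>M ?\<sigma>))" for x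
    proof -
      let ?f = "\<lambda>\<omega>. f \<omega> * exp (\<i> * complex_of_real (\<omega> \<bullet> x))"
      have "(fourier_extension f x)\<^sup>2 = (\<integral>p. ?f (fst p) * ?f (snd p) \<partial>(?\<sigma> \<Otimes>\<^sub>M ?\<sigma>))"
        unfolding fourier_extension_def power2_eq_square
        by (rule sphere2.integral_mult_product[symmetric]; rule integrable_fourier_extension[OF fi])
      also have "\<dots> = (\<integral>p. ?h p * exp (\<i> * complex_of_real (?s p \<bullet> x)) \<partial>(?\<sigma> \<Otimes>\<^sub>M ?\<sigma>))"
        by (intro Bochner_Integration.integral_cong refl) (simp add: inner_add_left distrib_left exp_add)
      finally show ?thesis .
    qed
    have "(\<integral>\<^sup>+x. ennreal (cmod (fourier_extension f x) ^ 4 * gauss_weight \<delta> x) \<partial>lborel)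
      = (\<integral>\<^sup>+x. ennreal ((cmod (\<integral>p. ?h p * exp (\<i> * complex_of_real (?s p \<bullet> x)) \<partial>(?\<sigma> \<Otimes>\<^sub>M ?\<sigma>)))\<^sup>2 * gauss_weight \<delta> x) \<partial>lborel)"
      unfolding sq[symmetric] norm_power by (simp flip: power_mult)
    also have "\<dots> \<le> ennreal (sqrt (2 * pi) ^ DIM(real ^ 'n)) * ennreal C * (\<integral>\<^sup>+p. ennreal ((cmod (?h p))\<^sup>2) \<partial>(?\<sigma> \<Otimes>\<^sub>M ?\<sigma>))"
    proof (rule weighted_fourier_square_schur[OF _ _ _ \<delta>])
      show "sigma_finite_measure (?\<sigma> \<Otimes>\<^sub>M ?\<sigma>)" by unfold_locales
      show "integrable (?\<sigma> \<Otimes>\<^sub>M ?\<sigma>) ?h" by (rule sphere2.integrable_mult_product[OF fi fi])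
      show "?s \<in> borel_measurable (?\<sigma> \<Otimes>\<^sub>M ?\<sigma>)" by measurable
      fix p assume "?h p \<noteq> 0"
      then have "fst p \<in> ball c (1/2)" "snd p \<in> ball c (1/2)" using supp by auto
      then have "norm (c - fst p) + norm (c - snd p) < 1" by (simp add: dist_norm)
      moreover have "norm (2 *\<^sub>R c) \<le> norm (?s p) + norm ((c - fst p) + (c - snd p))"
        using norm_triangle_ineq[of "?s p" "(c - fst p) + (c - snd p)"] by (simp add: scaleR_2 algebra_simps)
      moreover have "norm ((c - fst p) + (c - snd p)) \<le> norm (c - fst p) + norm (c - snd p)" by (rule norm_triangle_ineq)
      ultimately have p: "1 \<le> norm (?s p)" using c by simp
      have "(\<integral>\<^sup>+q. ennreal (exp (- (norm (?s p - ?s q) / \<delta>)\<^sup>2 / 2) / \<delta> ^ DIM(real ^ 'n)) \<partial>(?\<sigma> \<Otimes>\<^sub>M ?\<sigma>))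
        = (\<integral>\<^sup>+\<omega>. \<integral>\<^sup>+\<nu>. ennreal (exp (- (norm (?s p - (\<omega> + \<nu>)) / \<delta>)\<^sup>2 / 2) / \<delta> ^ CARD('n)) \<partial>?\<sigma> \<partial>?\<sigma>)"
        by (subst sphere.nn_integral_fst[symmetric]) simp_all
      also have "\<dots> \<le> ennreal C" by (rule C[OF p \<delta>])
      finally show "(\<integral>\<^sup>+q. ennreal (exp (- (norm (?s p - ?s q) / \<delta>)\<^sup>2 / 2) / \<delta> ^ DIM(real ^ 'n)) \<partial>(?\<sigma> \<Otimes>\<^sub>M ?\<sigma>)) \<le> ennreal C" .
    qed
    also have "(\<integral>\<^sup>+p. ennreal ((cmod (?h p))\<^sup>2) \<partial>(?\<sigma> \<Otimes>\<^sub>M ?\<sigma>)) = ennreal (L2_sphere_norm f ^ 4)"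
    proof -
      have "(\<integral>\<^sup>+p. ennreal ((cmod (?h p))\<^sup>2) \<partial>(?\<sigma> \<Otimes>\<^sub>M ?\<sigma>))
        = ennreal (\<integral>p. (cmod (f (fst p)))\<^sup>2 * (cmod (f (snd p)))\<^sup>2 \<partial>(?\<sigma> \<Otimes>\<^sub>M ?\<sigma>))"
        by (subst nn_integral_eq_integral[symmetric, OF sphere2.integrable_mult_product[OF f2 f2]])
           (simp_all add: norm_mult power_mult_distrib)
      then show ?thesis
        by (simp only: sphere2.integral_mult_product[OF f2 f2] L2_sphere_norm_power4
            power2_eq_square[of "\<integral>\<omega>. (cmod (f \<omega>))\<^sup>2 \<partial>?\<sigma>"])
    qed
    finally show "(\<integral>\<^sup>+x. ennreal (cmod (fourier_extension f x) ^ 4 * gauss_weight \<delta> x) \<partial>lborel) \<le> ennreal (?K * L2_sphere_norm f ^ 4)"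
      using C0 by (simp add: ennreal_mult)
  qed
qed

lemma cmod_add_power4_le: "cmod (u + v) ^ 4 \<le> 8 * (cmod u ^ 4 + cmod v ^ 4)"
proof -
  have sq: "(x + y)\<^sup>2 \<le> 2 * (x\<^sup>2 + y\<^sup>2)" for x y :: real
    using sum_squares_bound[of x y] by (simp add: power2_sum)
  have "cmod (u + v) ^ 4 \<le> (cmod u + cmod v) ^ 4"
    by (intro power_mono norm_triangle_ineq) auto
  also have "\<dots> = ((cmod u + cmod v)\<^sup>2)\<^sup>2" by simp
  also have "\<dots> \<le> (2 * ((cmod u)\<^sup>2 + (cmod v)\<^sup>2))\<^sup>2"
    by (intro power_mono sq) auto
  also have "\<dots> = 4 * ((cmod u)\<^sup>2 + (cmod v)\<^sup>2)\<^sup>2"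
    unfolding power_mult_distrib by simp
  also have "\<dots> \<le> 4 * (2 * (((cmod u)\<^sup>2)\<^sup>2 + ((cmod v)\<^sup>2)\<^sup>2))"
    by (intro mult_left_mono sq) auto
  finally show ?thesis by simp
qed

lemma L2_sphere_restrict:
  fixes f :: "real ^ 'n \<Rightarrow> complex"
  assumes f: "f \<in> L2_sphere" and A [measurable]: "A \<in> sets borel"
  shows "(\<lambda>\<omega>. indicator A \<omega> * f \<omega>) \<in> L2_sphere"
    and "L2_sphere_norm (\<lambda>\<omega>. indicator A \<omega> * f \<omega>) ^ 4 \<le> L2_sphere_norm f ^ 4"
proof -
  note [measurable] = L2_sphere_measurable[OF f]
  have int: "integrable sphere_measure (\<lambda>\<omega>. (cmod (indicator A \<omega> * f \<omega>))\<^sup>2)"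
    by (rule Bochner_Integration.integrable_bound[OF L2_sphere_square_integrable[OF f]])
       (measurable, auto simp: indicator_def)
  then show "(\<lambda>\<omega>. indicator A \<omega> * f \<omega>) \<in> L2_sphere"
    unfolding L2_sphere_def by simp
  show "L2_sphere_norm (\<lambda>\<omega>. indicator A \<omega> * f \<omega>) ^ 4 \<le> L2_sphere_norm f ^ 4"
    unfolding L2_sphere_norm_power4
    by (intro power_mono integral_mono int L2_sphere_square_integrable[OF f]) (auto simp: indicator_def)
qed

lemma fourier_extension_L4_bound:
  assumes dim: "CARD('n::finite) \<ge> 3"
  obtains K where "K \<ge> 0" and
    "\<And>(f :: real ^ 'n \<Rightarrow> complex) \<delta>. f \<in> L2_sphere \<Longrightarrow> \<delta> > 0 \<Longrightarrow>
      (\<integral>\<^sup>+x. ennreal (cmod (fourier_extension f x) ^ 4 * gauss_weight \<delta> x) \<partial>lborel)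
        \<le> ennreal (K * L2_sphere_norm f ^ 4)"
proof -
  let ?N = "\<lambda>\<delta> (f :: real ^ 'n \<Rightarrow> complex). \<integral>\<^sup>+x. ennreal (cmod (fourier_extension f x) ^ 4 * gauss_weight \<delta> x) \<partial>lborel"
  \<comment> \<open>Hiding the constant in the predicate lets it grow along the induction over a
    finite cover, by a factor 8 per union; it must not depend on \<open>\<delta>\<close>.\<close>
  define good where "good A \<longleftrightarrow> (\<exists>K\<ge>0. \<forall>(f :: real ^ 'n \<Rightarrow> complex) \<delta>. f \<in> L2_sphere \<longrightarrow>
     \<delta> > 0 \<longrightarrow> (\<forall>\<omega>. \<omega> \<notin> A \<longrightarrow> f \<omega> = 0) \<longrightarrow> ?N \<delta> f \<le> ennreal (K * L2_sphere_norm f ^ 4))" for A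
  obtain K0 where K0: "K0 \<ge> 0"
    "\<And>c (f :: real ^ 'n \<Rightarrow> complex) \<delta>. norm c = 1 \<Longrightarrow> f \<in> L2_sphere \<Longrightarrow> (\<And>\<omega>. \<omega> \<notin> ball c (1/2) \<Longrightarrow> f \<omega> = 0) \<Longrightarrow>
      \<delta> > 0 \<Longrightarrow> ?N \<delta> f \<le> ennreal (K0 * L2_sphere_norm f ^ 4)"
    using fourier_extension_local_bound[OF dim] by blast
  have good_ball: "good (ball c (1/2))" if "norm c = 1" for c
    unfolding good_def
  proof (intro exI[of _ K0] conjI allI impI K0(1))
    fix f :: "real ^ 'n \<Rightarrow> complex" and \<delta> :: real
    assume "f \<in> L2_sphere" "\<delta> > 0" "\<forall>\<omega>. \<omega> \<notin> ball c (1/2) \<longrightarrow> f \<omega> = 0"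
    then show "?N \<delta> f \<le> ennreal (K0 * L2_sphere_norm f ^ 4)"
      by (intro K0(2)[OF that]) auto
  qed
  have good_Un: "good (A \<union> B)" if A: "good A" "A \<in> sets borel" and B: "good B" for A B
  proof -
    obtain K1 where K1: "K1 \<ge> 0" "\<And>f \<delta>. f \<in> L2_sphere \<Longrightarrow> \<delta> > 0 \<Longrightarrow> (\<And>\<omega>. \<omega> \<notin> A \<Longrightarrow> f \<omega> = 0) \<Longrightarrow>
        ?N \<delta> f \<le> ennreal (K1 * L2_sphere_norm f ^ 4)"
      using A(1) unfolding good_def by blast
    obtain K2 where K2: "K2 \<ge> 0" "\<And>f \<delta>. f \<in> L2_sphere \<Longrightarrow> \<delta> > 0 \<Longrightarrow> (\<And>\<omega>. \<omega> \<notin> B \<Longrightarrow> f \<omega> = 0) \<Longrightarrow>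
        ?N \<delta> f \<le> ennreal (K2 * L2_sphere_norm f ^ 4)"
      using B unfolding good_def by blast
    show ?thesis unfolding good_def
    proof (intro exI[of _ "8 * (K1 + K2)"] conjI allI impI)
      show "0 \<le> 8 * (K1 + K2)" using K1 K2 by simp
      fix f :: "real ^ 'n \<Rightarrow> complex" and \<delta> :: real
      assume f: "f \<in> L2_sphere" and \<delta>: "\<delta> > 0" and supp: "\<forall>\<omega>. \<omega> \<notin> A \<union> B \<longrightarrow> f \<omega> = 0"
      \<comment> \<open>Cutting with \<open>A\<close> and its complement makes the pieces disjoint.
        The second piece is supported in \<open>B\<close> because \<open>f\<close> vanishes off the
        union.\<close>
      let ?u = "\<lambda>\<omega>. indicator A \<omega> * f \<omega>" and ?v = "\<lambda>\<omega>. indicator (- A) \<omega> * f \<omega>"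
      have A': "- A \<in> sets borel" using A(2) by (simp add: Compl_in_sets_lebesgue borel_comp)
      note u = L2_sphere_restrict[OF f A(2)] and v = L2_sphere_restrict[OF f A']
      have "f = (\<lambda>\<omega>. ?u \<omega> + ?v \<omega>)" by (auto simp: indicator_def)
      then have T: "fourier_extension f x = fourier_extension ?u x + fourier_extension ?v x" for x
        using fourier_extension_add[OF u(1)[THEN L2_sphere_integrable] v(1)[THEN L2_sphere_integrable]] by simp
      have "?N \<delta> f \<le> (\<integral>\<^sup>+x. ennreal 8 * (ennreal (cmod (fourier_extension ?u x) ^ 4 * gauss_weight \<delta> x)
          + ennreal (cmod (fourier_extension ?v x) ^ 4 * gauss_weight \<delta> x)) \<partial>lborel)"
      proof (intro nn_integral_mono)
        fix x
        have "cmod (fourier_extension f x) ^ 4 * gauss_weight \<delta> x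
          \<le> 8 * (cmod (fourier_extension ?u x) ^ 4 + cmod (fourier_extension ?v x) ^ 4) * gauss_weight \<delta> x"
          unfolding T by (intro mult_right_mono cmod_add_power4_le) auto
        also have "\<dots> = 8 * (cmod (fourier_extension ?u x) ^ 4 * gauss_weight \<delta> x
           + cmod (fourier_extension ?v x) ^ 4 * gauss_weight \<delta> x)" by (simp add: algebra_simps)
        finally have "ennreal (cmod (fourier_extension f x) ^ 4 * gauss_weight \<delta> x) \<le> ennreal \<dots>"
          by (rule ennreal_leI)
        then show "ennreal (cmod (fourier_extension f x) ^ 4 * gauss_weight \<delta> x)
          \<le> ennreal 8 * (ennreal (cmod (fourier_extension ?u x) ^ 4 * gauss_weight \<delta> x)
          + ennreal (cmod (fourier_extension ?v x) ^ 4 * gauss_weight \<delta> x))"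
          by (subst (asm) ennreal_mult) (auto simp: ennreal_plus)
      qed
      also have "\<dots> = ennreal 8 * (?N \<delta> ?u + ?N \<delta> ?v)"
      proof -
        have m: "(\<lambda>x. ennreal (cmod (fourier_extension g x) ^ 4 * gauss_weight \<delta> x)) \<in> borel_measurable lborel"
          if g: "g \<in> borel_measurable sphere_measure" for g :: "real ^ 'n \<Rightarrow> complex"
        proof -
          have "gauss_weight \<delta> \<in> borel_measurable (lborel :: (real ^ 'n) measure)"
            by (simp only: measurable_lborel2) (intro borel_measurable_continuous_onI continuous_intros, simp)
          moreover have "fourier_extension g \<in> borel_measurable lborel"
            using borel_measurable_fourier_extension[OF g] by simp
          ultimately show ?thesis
            by (intro measurable_compose[OF _ measurable_ennreal] borel_measurable_times borel_measurable_power
                measurable_compose[OF _ borel_measurable_norm])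
        qed
        have "?N \<delta> ?u + ?N \<delta> ?v = (\<integral>\<^sup>+x. ennreal (cmod (fourier_extension ?u x) ^ 4 * gauss_weight \<delta> x)
          + ennreal (cmod (fourier_extension ?v x) ^ 4 * gauss_weight \<delta> x) \<partial>lborel)"
          by (intro nn_integral_add[symmetric] m u(1)[THEN L2_sphere_measurable] v(1)[THEN L2_sphere_measurable])
        then show ?thesis
          by (simp only:) (intro nn_integral_cmult borel_measurable_add m u(1)[THEN L2_sphere_measurable] v(1)[THEN L2_sphere_measurable])
      qed
      also have "\<dots> \<le> ennreal 8 * (ennreal (K1 * L2_sphere_norm f ^ 4) + ennreal (K2 * L2_sphere_norm f ^ 4))"
      proof (intro mult_left_mono add_mono)
        show "?N \<delta> ?u \<le> ennreal (K1 * L2_sphere_norm f ^ 4)"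
          using K1(1) u(2) by (intro order_trans[OF K1(2)[OF u(1) \<delta>]] ennreal_leI mult_left_mono) auto
        have "?v \<omega> = 0" if "\<omega> \<notin> B" for \<omega> using that supp by (auto simp: indicator_def)
        then show "?N \<delta> ?v \<le> ennreal (K2 * L2_sphere_norm f ^ 4)"
          using K2(1) v(2) by (intro order_trans[OF K2(2)[OF v(1) \<delta>]] ennreal_leI mult_left_mono) auto
      qed auto
      also have "\<dots> = ennreal (8 * (K1 + K2) * L2_sphere_norm f ^ 4)"
      proof -
        define X where "X = L2_sphere_norm f ^ 4"
        have "X \<ge> 0" by (simp add: X_def)
        then have "ennreal (8 * (K1 * X + K2 * X)) = ennreal 8 * (ennreal (K1 * X) + ennreal (K2 * X))"
          using K1(1) K2(1) by (subst ennreal_mult) (auto simp: ennreal_plus)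
        moreover have "8 * (K1 * X + K2 * X) = 8 * (K1 + K2) * X" by (simp add: algebra_simps)
        ultimately show ?thesis by (simp only: X_def)
      qed
      finally show "?N \<delta> f \<le> ennreal (8 * (K1 + K2) * L2_sphere_norm f ^ 4)" .
    qed
  qed
  have good_empty: "good {}"
    unfolding good_def
  proof (intro exI[of _ 0] conjI allI impI)
    fix f :: "real ^ 'n \<Rightarrow> complex" and \<delta> :: real assume "\<forall>\<omega>. \<omega> \<notin> {} \<longrightarrow> f \<omega> = 0"
    then have "fourier_extension f x = 0" for x by (simp add: fourier_extension_def)
    then show "?N \<delta> f \<le> ennreal (0 * L2_sphere_norm f ^ 4)" by simp
  qed simp
  have good_UN: "good (\<Union>c\<in>I. ball c (1/2))" if "finite I" "I \<subseteq> sphere 0 1" for I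
    using that
  proof (induction I rule: finite_induct)
    case (insert c I)
    then show ?case using good_Un[OF good_ball[of c], of "\<Union>c\<in>I. ball c (1/2)"] by simp
  qed (simp add: good_empty)
  have "sphere 0 1 \<subseteq> (\<Union>c\<in>sphere 0 1. ball c (1/2 :: real))" by auto
  then obtain I where I: "I \<subseteq> sphere 0 1" "finite I" "sphere 0 1 \<subseteq> (\<Union>c\<in>I. ball c (1/2) :: (real ^ 'n) set)"
    using compactE_image[OF compact_sphere, of "sphere 0 1" "\<lambda>c. ball c (1/2)" 0 1] by auto
  let ?U = "\<Union>c\<in>I. ball c (1/2) :: (real ^ 'n) set"
  obtain K where K: "K \<ge> 0" "\<And>f \<delta>. f \<in> L2_sphere \<Longrightarrow> \<delta> > 0 \<Longrightarrow> (\<And>\<omega>. \<omega> \<notin> ?U \<Longrightarrow> f \<omega> = 0) \<Longrightarrow>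
        ?N \<delta> f \<le> ennreal (K * L2_sphere_norm f ^ 4)"
    using good_UN[OF I(2,1)] unfolding good_def by blast
  show ?thesis
  proof (rule that[OF K(1)])
    fix f :: "real ^ 'n \<Rightarrow> complex" and \<delta> :: real assume f: "f \<in> L2_sphere" and \<delta>: "\<delta> > 0"
    have U: "?U \<in> sets borel" by (intro borel_open open_UN) auto
    let ?f = "\<lambda>\<omega>. indicator ?U \<omega> * f \<omega>"
    \<comment> \<open>The cover contains the sphere, so cutting off changes \<open>f\<close> only
      where the surface measure does not see it.\<close>
    have "fourier_extension f x = fourier_extension ?f x" for x
      unfolding fourier_extension_def
      by (intro Bochner_Integration.integral_cong refl) (use I(3) in \<open>auto simp: indicator_def\<close>)
    then have "?N \<delta> f = ?N \<delta> ?f" by simp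
    also have "\<dots> \<le> ennreal (K * L2_sphere_norm ?f ^ 4)"
      by (intro K(2) L2_sphere_restrict f U \<delta>) auto
    also have "\<dots> \<le> ennreal (K * L2_sphere_norm f ^ 4)"
      by (intro ennreal_leI mult_left_mono L2_sphere_restrict f U K(1))
    finally show "?N \<delta> f \<le> ennreal (K * L2_sphere_norm f ^ 4)" .
  qed
qed

subsection \<open>Rotation invariance\<close>

text \<open>The library proves this only for \<open>real ^ 'n\<close> with a well-ordered index type. Averaging the
  preimage of a set over translates by the unit ball reduces the claim to the invariance of balls.\<close>

lemma lborel_distr_orthogonal_transformation:
  fixes R :: "'a::euclidean_space \<Rightarrow> 'a"
  assumes R: "orthogonal_transformation R"
  shows "distr lborel borel R = lborel"
proof (rule measure_eqI)
  have lin: "linear R" using R by (rule orthogonal_transformation_linear)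
  define R' where "R' = inv R"
  have R': "orthogonal_transformation R'" unfolding R'_def by (rule orthogonal_transformation_inv[OF R])
  have RR': "R (R' z) = z" for z
    unfolding R'_def by (rule surj_f_inv_f[OF orthogonal_transformation_surj[OF R]])
  have mR [measurable]: "R \<in> borel_measurable borel"
    by (intro borel_measurable_continuous_onI linear_continuous_on linear_conv_bounded_linear[THEN iffD1] lin)
  have mR' [measurable]: "R' \<in> borel_measurable borel"
    by (intro borel_measurable_continuous_onI linear_continuous_on linear_conv_bounded_linear[THEN iffD1]
        orthogonal_transformation_linear R')
  fix A assume "A \<in> sets (distr lborel borel R)"
  then have A [measurable]: "A \<in> sets borel" by simp
  let ?b = "emeasure lborel (ball 0 1 :: 'a set)"
  have RA: "R -` A \<in> sets borel" using measurable_sets[OF mR A] by simp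
  \<comment> \<open>Since \<open>R (x + R' z) = R x + z\<close>, the section is a translate of the
    part of \<open>A\<close> in the unit ball about \<open>R x\<close>.\<close>
  have 1: "emeasure lborel {z\<in>ball 0 1. x + R' z \<in> R -` A} = (\<integral>\<^sup>+z. indicator A z * indicator (ball (R x) 1) z \<partial>lborel)" for x
  proof -
    have "{z\<in>ball 0 1. x + R' z \<in> R -` A} = {z. R x + z \<in> A \<inter> ball (R x) 1}"
      by (auto simp: linear_add[OF lin] RR' dist_norm)
    then have "emeasure lborel {z\<in>ball 0 1. x + R' z \<in> R -` A} = emeasure lborel (A \<inter> ball (R x) 1)"
      by (simp only:) (rule emeasure_lborel_translate, simp add: A)
    also have "\<dots> = (\<integral>\<^sup>+z. indicator (A \<inter> ball (R x) 1) z \<partial>lborel)"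
      by (subst nn_integral_indicator) (auto simp: A)
    finally show ?thesis by (simp only: indicator_inter_arith)
  qed
  \<comment> \<open>The points \<open>x\<close> for which \<open>R x\<close> is within 1 of
    \<open>z\<close> form the unit ball about \<open>R' z\<close>, because \<open>R\<close> is an
    isometry.\<close>
  have 2: "(\<integral>\<^sup>+x. indicator (ball (R x) 1) z \<partial>lborel) = ?b" for z
  proof -
    have "dist (R x) z = dist (R' z) x" for x
    proof -
      have "R x - z = R (x - R' z)" by (simp add: linear_diff[OF lin] RR')
      then show ?thesis by (simp add: dist_norm orthogonal_transformation_norm[OF R] norm_minus_commute)
    qed
    then have "(\<integral>\<^sup>+x. indicator (ball (R x) 1) z \<partial>lborel) = (\<integral>\<^sup>+x. indicator (ball (R' z) 1) x \<partial>lborel)"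
      by (intro nn_integral_cong) (simp add: indicator_def)
    also have "\<dots> = ?b" by (simp add: emeasure_ball)
    finally show ?thesis .
  qed
  have "?b * emeasure lborel (R -` A) = (\<integral>\<^sup>+x. \<integral>\<^sup>+z. indicator A z * indicator (ball (R x) 1) z \<partial>lborel \<partial>lborel)"
    by (subst emeasure_average_translates[OF RA _ mR']) (simp_all only: 1 borel_open open_ball)
  also have "\<dots> = (\<integral>\<^sup>+z. \<integral>\<^sup>+x. indicator A z * indicator (ball (R x) 1) z \<partial>lborel \<partial>lborel)"
    by (rule lborel_pair.Fubini') (unfold indicator_def mem_ball, measurable)
  also have "\<dots> = (\<integral>\<^sup>+z. indicator A z * (\<integral>\<^sup>+x. indicator (ball (R x) 1) z \<partial>lborel) \<partial>lborel)"
    by (intro nn_integral_cong nn_integral_cmult) (unfold indicator_def mem_ball, measurable)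
  also have "\<dots> = ?b * emeasure lborel A"
    unfolding 2 by (simp add: nn_integral_multc mult.commute)
  moreover have "unit_ball_vol (real DIM('a)) > 0" by simp
  then have "unit_ball_vol (real DIM('a)) \<noteq> 0" by linarith
  then have "?b \<noteq> 0" "?b \<noteq> \<infinity>" by (auto simp: emeasure_ball)
  ultimately have "emeasure lborel (R -` A) = emeasure lborel A"
    by (simp add: ennreal_mult_cancel_left)
  then show "emeasure (distr lborel borel R) A = emeasure lborel A"
    by (subst emeasure_distr) auto
qed simp

text \<open>\<open>R\<close> commutes with radial projection, so the cone over a preimage is the
  preimage of the cone, and the invariance of Lebesgue measure carries over.\<close>

lemma sphere_distr_orthogonal_transformation:
  fixes R :: "real ^ 'n \<Rightarrow> real ^ 'n"
  assumes R: "orthogonal_transformation R"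
  shows "R \<in> measurable sphere_measure sphere_measure"
    and "distr sphere_measure sphere_measure R = sphere_measure"
proof -
  let ?\<sigma> = "sphere_measure :: (real ^ 'n) measure"
  have lin: "linear R" using R by (rule orthogonal_transformation_linear)
  then have Rb [measurable]: "R \<in> borel_measurable borel"
    by (intro borel_measurable_continuous_onI linear_continuous_on linear_conv_bounded_linear[THEN iffD1])
  have norm: "norm (R x) = norm x" for x using R by (rule orthogonal_transformation_norm)
  show Rm: "R \<in> measurable ?\<sigma> ?\<sigma>"
    unfolding measurable_cong_sets[OF sets_sphere_measure sets_sphere_measure]
    by (rule measurable_restrict_space3[OF Rb]) (auto simp: norm)
  show "distr ?\<sigma> ?\<sigma> R = ?\<sigma>"
  proof (rule measure_eqI)
    fix A assume "A \<in> sets (distr ?\<sigma> ?\<sigma> R)"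
    then have A: "A \<in> sets ?\<sigma>" by simp
    then have A': "A \<in> sets borel" "A \<subseteq> sphere 0 1"
      by (auto simp: sets_sphere_measure sets_restrict_space_iff)
    let ?B = "{x. 0 < norm x \<and> norm x < 1 \<and> x /\<^sub>R norm x \<in> A}"
    have B: "?B \<in> sets borel" using A'(1) by measurable
    have RA: "R -` A \<inter> sphere 0 1 \<in> sets borel"
      using measurable_sets[OF Rb A'(1)] by auto
    have "emeasure (distr ?\<sigma> ?\<sigma> R) A = emeasure ?\<sigma> (R -` A \<inter> sphere 0 1)"
      using emeasure_distr[OF Rm A] by simp
    also have "\<dots> = of_nat CARD('n) * emeasure lborel {x. 0 < norm x \<and> norm x < 1 \<and> x /\<^sub>R norm x \<in> R -` A \<inter> sphere 0 1}"
      by (rule emeasure_sphere_measure[OF RA]) auto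
    also have "{x. 0 < norm x \<and> norm x < 1 \<and> x /\<^sub>R norm x \<in> R -` A \<inter> sphere 0 1} = R -` ?B \<inter> space lborel"
    proof -
      have "R (x /\<^sub>R norm x) \<in> A \<and> x /\<^sub>R norm x \<in> sphere 0 1 \<longleftrightarrow> R x /\<^sub>R norm x \<in> A" if "0 < norm x" for x
        using that by (simp add: linear_scale[OF lin])
      then show ?thesis
        unfolding vimage_def mem_Collect_eq Int_iff norm by auto
    qed
    also have "emeasure lborel (R -` ?B \<inter> space lborel) = emeasure (distr lborel borel R) ?B"
      using B by (intro emeasure_distr[symmetric]) auto
    also have "of_nat CARD('n) * emeasure (distr lborel borel R) ?B = emeasure ?\<sigma> A"
      by (simp only: lborel_distr_orthogonal_transformation[OF R] emeasure_sphere_measure[OF A'])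
    finally show "emeasure (distr ?\<sigma> ?\<sigma> R) A = emeasure ?\<sigma> A" .
  qed simp
qed

lemma fourier_extension_one_orthogonal:
  fixes R :: "real ^ 'n \<Rightarrow> real ^ 'n"
  assumes R: "orthogonal_transformation R"
  shows "fourier_extension (\<lambda>_. 1) (R x) = fourier_extension (\<lambda>_. 1) x"
proof -
  have m: "(\<lambda>\<omega>. 1 * exp (\<i> * complex_of_real (\<omega> \<bullet> R x))) \<in> borel_measurable (sphere_measure :: (real ^ 'n) measure)"
    by measurable
  have "fourier_extension (\<lambda>_. 1) (R x) = (\<integral>\<omega>. 1 * exp (\<i> * complex_of_real (\<omega> \<bullet> R x)) \<partial>distr sphere_measure sphere_measure R)"
    by (simp only: fourier_extension_def sphere_distr_orthogonal_transformation(2)[OF R])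
  also have "\<dots> = (\<integral>\<omega>. 1 * exp (\<i> * complex_of_real (R \<omega> \<bullet> R x)) \<partial>sphere_measure)"
    by (rule integral_distr[OF sphere_distr_orthogonal_transformation(1)[OF R] m])
  also have "\<dots> = fourier_extension (\<lambda>_. 1) x"
    using R by (simp add: fourier_extension_def orthogonal_transformation_def)
  finally show ?thesis .
qed

lemma cmod_fourier_extension_le:
  fixes f :: "real ^ 'n \<Rightarrow> complex"
  assumes "integrable sphere_measure f"
  shows "cmod (fourier_extension f x) \<le> (\<integral>\<omega>. cmod (f \<omega>) \<partial>sphere_measure)"
proof -
  have "cmod (fourier_extension f x) \<le> (\<integral>\<omega>. cmod (f \<omega> * exp (\<i> * complex_of_real (\<omega> \<bullet> x))) \<partial>sphere_measure)"
    unfolding fourier_extension_def by (rule integral_norm_bound)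
  then show ?thesis by (simp add: norm_mult)
qed

lemma integrable_gauss_weight_mult:
  fixes F :: "'a::euclidean_space \<Rightarrow> 'b::{banach, real_normed_field, second_countable_topology}"
  assumes F: "F \<in> borel_measurable borel" and B: "\<And>x. norm (F x) \<le> B" and \<delta>: "\<delta> > 0"
  shows "integrable lborel (\<lambda>x. of_real (gauss_weight \<delta> x) * F x)"
proof (rule Bochner_Integration.integrable_bound)
  show "integrable lborel (\<lambda>x::'a. B * gauss_weight \<delta> x)"
    by (intro integrable_mult_right gaussian_fourier(1)[OF \<delta>])
  show "(\<lambda>x. of_real (gauss_weight \<delta> x) * F x) \<in> borel_measurable lborel"
    using F by measurable
  have "B \<ge> 0" using B[of 0] norm_ge_zero order_trans by blast
  then show "AE x in lborel. norm (of_real (gauss_weight \<delta> x) * F x) \<le> norm (B * gauss_weight \<delta> x)"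
    using B by (auto simp: norm_mult mult.commute intro!: mult_left_mono)
qed

text \<open>The inner integral over \<open>x\<close> is a radial function of \<open>\<omega>\<close>, hence constant on the sphere.\<close>

lemma fourier_extension_linear_term:
  fixes g :: "real ^ 'n \<Rightarrow> complex"
  assumes g: "integrable sphere_measure g" and g0: "(\<integral>\<omega>. g \<omega> \<partial>sphere_measure) = 0" and \<delta>: "\<delta> > 0"
  defines "\<tau> \<equiv> fourier_extension (\<lambda>_::real ^ 'n. 1)"
  shows "(\<integral>x. complex_of_real (gauss_weight \<delta> x) * ((cmod (\<tau> x))\<^sup>2 * cnj (\<tau> x) * fourier_extension g x) \<partial>lborel) = 0"
proof -
  let ?\<sigma> = "sphere_measure :: (real ^ 'n) measure"
  let ?e = "\<lambda>\<omega> x. exp (\<i> * complex_of_real (\<omega> \<bullet> x))"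
  interpret LS: pair_sigma_finite "lborel :: (real ^ 'n) measure" ?\<sigma> ..
  define k where "k x = complex_of_real (gauss_weight \<delta> x) * ((cmod (\<tau> x))\<^sup>2 * cnj (\<tau> x))" for x
  have one: "integrable ?\<sigma> (\<lambda>_. 1 :: complex)" by simp
  have \<tau>m [measurable]: "\<tau> \<in> borel_measurable borel"
    unfolding \<tau>_def by (rule borel_measurable_fourier_extension) simp
  have cnjm [measurable]: "cnj \<in> borel_measurable borel"
    by (intro borel_measurable_continuous_onI continuous_intros)
  define B where "B = (\<integral>\<omega>. cmod 1 \<partial>?\<sigma>)"
  have B: "cmod (\<tau> x) \<le> B" for x
    unfolding \<tau>_def B_def by (rule cmod_fourier_extension_le[OF one])
  have k: "integrable lborel k"
    unfolding k_def
  proof (rule integrable_gauss_weight_mult[OF _ _ \<delta>])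
    show "(\<lambda>x. complex_of_real ((cmod (\<tau> x))\<^sup>2) * cnj (\<tau> x)) \<in> borel_measurable borel" by measurable
    show "cmod (complex_of_real ((cmod (\<tau> x))\<^sup>2) * cnj (\<tau> x)) \<le> B\<^sup>2 * B" for x
      unfolding norm_mult complex_mod_cnj
      using B[of x] by (intro mult_mono) (auto intro!: power_mono simp: norm_power)
  qed
  have gm: "g \<in> borel_measurable ?\<sigma>" using g by (rule borel_measurable_integrable)
  have I: "integrable (lborel \<Otimes>\<^sub>M ?\<sigma>) (\<lambda>(x, \<omega>). k x * (g \<omega> * ?e \<omega> x))"
  proof (rule Bochner_Integration.integrable_bound[OF LS.integrable_mult_product[OF k g]])
    show "(\<lambda>(x, \<omega>). k x * (g \<omega> * ?e \<omega> x)) \<in> borel_measurable (lborel \<Otimes>\<^sub>M ?\<sigma>)"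
      using gm k[THEN borel_measurable_integrable] by measurable
  qed (auto simp: norm_mult)
  define H where "H \<omega> = (\<integral>x. k x * ?e \<omega> x \<partial>lborel)" for \<omega>
  \<comment> \<open>Substitute \<open>R x\<close> for \<open>x\<close>: Lebesgue measure,
    \<open>k\<close> and the inner product of two rotated vectors are all unchanged.\<close>
  have Hrot: "H (R \<omega>) = H \<omega>" if R: "orthogonal_transformation R" for R \<omega>
  proof -
    have lin: "linear R" using R by (rule orthogonal_transformation_linear)
    then have Rb: "R \<in> borel_measurable borel"
      by (intro borel_measurable_continuous_onI linear_continuous_on linear_conv_bounded_linear[THEN iffD1])
    have "H (R \<omega>) = (\<integral>x. k x * ?e (R \<omega>) x \<partial>distr lborel borel R)"
      by (simp only: H_def lborel_distr_orthogonal_transformation[OF R])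
    also have "\<dots> = (\<integral>x. k (R x) * ?e (R \<omega>) (R x) \<partial>lborel)"
    proof (rule integral_distr)
      show "R \<in> measurable lborel borel" using Rb by simp
      show "(\<lambda>x. k x * ?e (R \<omega>) x) \<in> borel_measurable borel"
        using k[THEN borel_measurable_integrable] by measurable
    qed
    also have "\<dots> = H \<omega>"
      using R unfolding H_def k_def \<tau>_def
      by (simp add: fourier_extension_one_orthogonal orthogonal_transformation_norm orthogonal_transformation_def)
    finally show ?thesis .
  qed
  obtain e0 :: "real ^ 'n" where e0: "norm e0 = 1" using norm_axis_1 by blast
  have Hconst: "H \<omega> = H e0" if \<omega>: "norm \<omega> = 1" for \<omega>
  proof -
    obtain R where "orthogonal_transformation R" "R e0 = \<omega>"
      using orthogonal_transformation_exists_1[OF e0 \<omega>] by blast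
    then show ?thesis using Hrot by metis
  qed
  have "(\<integral>x. complex_of_real (gauss_weight \<delta> x) * ((cmod (\<tau> x))\<^sup>2 * cnj (\<tau> x) * fourier_extension g x) \<partial>lborel)
    = (\<integral>x. \<integral>\<omega>. k x * (g \<omega> * ?e \<omega> x) \<partial>?\<sigma> \<partial>lborel)"
    by (simp only: k_def fourier_extension_def integral_mult_right_zero mult.assoc)
  also have "\<dots> = (\<integral>\<omega>. \<integral>x. k x * (g \<omega> * ?e \<omega> x) \<partial>lborel \<partial>?\<sigma>)"
    by (rule LS.Fubini_integral[symmetric, OF I])
  also have "\<dots> = (\<integral>\<omega>. H e0 * g \<omega> \<partial>?\<sigma>)"
  proof (intro Bochner_Integration.integral_cong refl)
    fix \<omega> :: "real ^ 'n" assume "\<omega> \<in> space ?\<sigma>"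
    then have "H \<omega> = H e0" by (intro Hconst) simp
    moreover have "(\<integral>x. k x * (g \<omega> * ?e \<omega> x) \<partial>lborel) = (\<integral>x. g \<omega> * (k x * ?e \<omega> x) \<partial>lborel)"
      by (simp only: mult.left_commute)
    then have "(\<integral>x. k x * (g \<omega> * ?e \<omega> x) \<partial>lborel) = g \<omega> * H \<omega>"
      by (simp only: H_def integral_mult_right_zero)
    ultimately show "(\<integral>x. k x * (g \<omega> * ?e \<omega> x) \<partial>lborel) = H e0 * g \<omega>" by simp
  qed
  also have "\<dots> = 0" by (simp add: g0)
  finally show ?thesis .
qed

subsection \<open>Perturbation of constants\<close>

text \<open>With \<open>a\<close>, \<open>b\<close> the moduli and \<open>r\<close> the real inner
  product, squaring a^2 + b^2 + 2 r produces the error terms 4 r^2, 2 a^2 b^2, 4 b^2 r and b^4. By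
  |r| \<le> a b and 2 a b^3 \<le> a^2 b^2 + b^4 they add up to at most (4 + 2 + 2) a^2 b^2 + (2 + 1)
  b^4. The linear term 4 a^2 r is kept exactly, since its integral is going to vanish.\<close>

lemma cmod_add_power4_expansion_le:
  "cmod (u + v) ^ 4 \<le> cmod u ^ 4 + 4 * (cmod u)\<^sup>2 * Re (cnj u * v) + 8 * ((cmod u)\<^sup>2 * (cmod v)\<^sup>2) + 3 * cmod v ^ 4"
proof -
  define a b r where "a = cmod u" and "b = cmod v" and "r = Re (cnj u * v)"
  have "\<bar>r\<bar> \<le> a * b"
    unfolding a_def b_def r_def using abs_Re_le_cmod[of "cnj u * v"] by (simp add: norm_mult)
  have ab: "a \<ge> 0" "b \<ge> 0" by (simp_all add: a_def b_def)
  have "r\<^sup>2 \<le> (a * b)\<^sup>2" using \<open>\<bar>r\<bar> \<le> a * b\<close> by (rule power2_le_iff_abs_le[THEN iffD2, rotated]) (use ab in simp)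
  moreover have "b\<^sup>2 * r \<le> b\<^sup>2 * (a * b)" using \<open>\<bar>r\<bar> \<le> a * b\<close> by (intro mult_left_mono) auto
  moreover have "2 * (b\<^sup>2 * (a * b)) \<le> (a * b)\<^sup>2 + b ^ 4"
    using sum_squares_bound[of "a * b" "b\<^sup>2"] by (simp add: algebra_simps)
  moreover have sq: "(cmod (u + v))\<^sup>2 = a\<^sup>2 + b\<^sup>2 + 2 * r"
    unfolding a_def b_def r_def cmod_power2 by (simp add: power2_eq_square algebra_simps)
  have "cmod (u + v) ^ 4 = ((cmod (u + v))\<^sup>2)\<^sup>2" by simp
  then have "cmod (u + v) ^ 4 = a ^ 4 + b ^ 4 + 4 * r\<^sup>2 + 2 * (a\<^sup>2 * b\<^sup>2) + 4 * a\<^sup>2 * r + 4 * (b\<^sup>2 * r)"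
    unfolding sq by (simp add: power2_eq_square power4_eq_xxxx algebra_simps)
  ultimately show ?thesis
    unfolding a_def[symmetric] b_def[symmetric] r_def[symmetric] power_mult_distrib by linarith
qed

text \<open>The weights tend to 1 pointwise along \<delta> = 1 / (n + 1), and Fatou's lemma passes
  the bound to the limit without presupposing that \<open>F\<close> is integrable.\<close>

lemma nn_integral_le_of_gauss_weighted_le:
  fixes F :: "'a::euclidean_space \<Rightarrow> real"
  assumes F: "F \<in> borel_measurable borel" and le: "\<And>\<delta>. \<delta> > 0 \<Longrightarrow> (\<integral>\<^sup>+x. ennreal (F x * gauss_weight \<delta> x) \<partial>lborel) \<le> B"
  shows "(\<integral>\<^sup>+x. ennreal (F x) \<partial>lborel) \<le> B"
proof -
  let ?d = "\<lambda>n. inverse (real (Suc n))"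
  have lim: "(\<lambda>n. ennreal (F x * gauss_weight (?d n) x)) \<longlonglongrightarrow> ennreal (F x)" for x
  proof -
    have "(\<lambda>n. F x * gauss_weight (?d n) x) \<longlonglongrightarrow> F x * gauss_weight 0 x"
      by (intro tendsto_intros LIMSEQ_inverse_real_of_nat) simp
    then show ?thesis by (intro tendsto_ennrealI) simp
  qed
  have "(\<integral>\<^sup>+x. ennreal (F x) \<partial>lborel) = (\<integral>\<^sup>+x. liminf (\<lambda>n. ennreal (F x * gauss_weight (?d n) x)) \<partial>lborel)"
    using lim_imp_Liminf[OF trivial_limit_sequentially lim] by simp
  also have "\<dots> \<le> liminf (\<lambda>n. \<integral>\<^sup>+x. ennreal (F x * gauss_weight (?d n) x) \<partial>lborel)"
    by (rule nn_integral_liminf) (use F in measurable)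
  also have "\<dots> \<le> liminf (\<lambda>n. B)"
    by (intro Liminf_mono always_eventually allI le) simp
  finally show ?thesis by (simp add: Liminf_const)
qed

lemma L2_sphere_const: "(\<lambda>_. c) \<in> L2_sphere"
  by (simp add: L2_sphere_def)

text \<open>The leading coefficient is the exact integral \<open>P\<close>, as sharpness at
  constants demands. The other terms contain a factor \<open>G\<close>, and there the lossy constant
  \<open>K\<close> is good enough.\<close>

lemma fourier_extension_L4_perturbation:
  fixes g :: "real ^ 'n \<Rightarrow> complex"
  assumes K: "K \<ge> 0" "\<And>(f :: real ^ 'n \<Rightarrow> complex) \<delta>. f \<in> L2_sphere \<Longrightarrow> \<delta> > 0 \<Longrightarrow>
      (\<integral>\<^sup>+x. ennreal (cmod (fourier_extension f x) ^ 4 * gauss_weight \<delta> x) \<partial>lborel)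
        \<le> ennreal (K * L2_sphere_norm f ^ 4)"
    and P: "P \<ge> 0" "(\<integral>\<^sup>+x. ennreal (cmod (fourier_extension (\<lambda>_::real ^ 'n. 1) x) ^ 4) \<partial>lborel) = ennreal P"
    and g: "g \<in> L2_sphere" "(\<integral>\<omega>. g \<omega> \<partial>sphere_measure) = 0"
    and G: "G = (\<integral>\<omega>. (cmod (g \<omega>))\<^sup>2 \<partial>sphere_measure)" "G > 0"
    and \<mu>: "\<mu> = measure sphere_measure (sphere 0 1 :: (real ^ 'n) set)"
  shows "(\<integral>\<^sup>+x. ennreal (cmod (fourier_extension (\<lambda>\<omega>. c + g \<omega>) x) ^ 4) \<partial>lborel)
    \<le> ennreal (cmod c ^ 4 * P + 8 * K * ((cmod c)\<^sup>2 * \<mu> * G) + 3 * K * G\<^sup>2)" (is "_ \<le> ennreal ?B")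
proof (rule nn_integral_le_of_gauss_weighted_le)
  let ?\<sigma> = "sphere_measure :: (real ^ 'n) measure"
  define \<tau> where "\<tau> = fourier_extension (\<lambda>_::real ^ 'n. 1)"
  define v where "v = fourier_extension g"
  have gi: "integrable ?\<sigma> g" by (rule L2_sphere_integrable[OF g(1)])
  have one: "integrable ?\<sigma> (\<lambda>_. 1 :: complex)" and ci: "integrable ?\<sigma> (\<lambda>_. c)" by simp_all
  have gm: "g \<in> borel_measurable ?\<sigma>" using g(1) by (rule L2_sphere_measurable)
  have [measurable]: "\<tau> \<in> borel_measurable borel" "v \<in> borel_measurable borel"
    unfolding \<tau>_def v_def by (auto intro!: borel_measurable_fourier_extension gm)
  have [measurable]: "cnj \<in> borel_measurable borel"
    by (intro borel_measurable_continuous_onI continuous_intros)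
  \<comment> \<open>A pointwise bound suffices to make every weighted term integrable, so that the
    expansion can be integrated term by term.\<close>
  obtain B where B: "\<And>x. cmod (\<tau> x) \<le> B" "\<And>x. cmod (v x) \<le> B"
    using cmod_fourier_extension_le[OF one] cmod_fourier_extension_le[OF gi]
    unfolding \<tau>_def v_def by (metis max.coboundedI1 max.coboundedI2)
  have T: "fourier_extension (\<lambda>\<omega>. c + g \<omega>) x = c * \<tau> x + v x" for x
    using fourier_extension_add[OF ci gi, of x] fourier_extension_cmult[of c "\<lambda>_. 1" x]
    by (simp add: \<tau>_def v_def)
  show "(\<lambda>x. cmod (fourier_extension (\<lambda>\<omega>. c + g \<omega>) x) ^ 4) \<in> borel_measurable borel"
    unfolding T by measurable
  fix \<delta> :: real assume \<delta>: "\<delta> > 0"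
  let ?w = "\<lambda>x::real ^ 'n. gauss_weight \<delta> x"
  have int: "integrable lborel (\<lambda>x. ?w x * F x)" if "F \<in> borel_measurable borel" "\<And>x. \<bar>F x\<bar> \<le> b" for F b
    using integrable_gauss_weight_mult[of F b \<delta>] that \<delta> by simp
  have B0: "B \<ge> 0" using B(1)[of 0] norm_ge_zero order_trans by blast
  have int4: "integrable lborel (\<lambda>x. ?w x * cmod (\<tau> x) ^ 4)" "integrable lborel (\<lambda>x. ?w x * cmod (v x) ^ 4)"
    by (rule int[where b = "B ^ 4"]; use B in \<open>auto intro!: power_mono\<close>)+
  have int22: "integrable lborel (\<lambda>x. ?w x * ((cmod (\<tau> x))\<^sup>2 * (cmod (v x))\<^sup>2))"
  proof (rule int[where b = "B\<^sup>2 * B\<^sup>2"])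
    fix x
    have "(cmod (\<tau> x))\<^sup>2 * (cmod (v x))\<^sup>2 \<le> B\<^sup>2 * B\<^sup>2"
      by (intro mult_mono power_mono B) auto
    then show "\<bar>(cmod (\<tau> x))\<^sup>2 * (cmod (v x))\<^sup>2\<bar> \<le> B\<^sup>2 * B\<^sup>2" by simp
  qed measurable
  have intc: "integrable lborel (\<lambda>x. complex_of_real (?w x) * ((cmod (\<tau> x))\<^sup>2 * cnj (\<tau> x) * v x))"
  proof (rule integrable_gauss_weight_mult[OF _ _ \<delta>])
    show "cmod ((cmod (\<tau> x))\<^sup>2 * cnj (\<tau> x) * v x) \<le> B\<^sup>2 * B * B" for x
      unfolding norm_mult complex_mod_cnj
      using B B0 by (intro mult_mono) (auto intro!: power_mono simp: norm_power)
  qed measurable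
  have Re_mult_real: "Re (complex_of_real s * z) = s * Re z" for s z by simp
  \<comment> \<open>The linear term of the expansion with the factor \<open>(cmod c)\<^sup>2\<close>
    taken out, arranged so that \<open>cnj c\<close> multiplies the complex integral already known
    to vanish.\<close>
  define r where "r x = Re (cnj c * ((cmod (\<tau> x))\<^sup>2 * cnj (\<tau> x) * v x))" for x
  have lin: "integrable lborel (\<lambda>x. ?w x * r x)" "(\<integral>x. ?w x * r x \<partial>lborel) = 0"
  proof -
    have eq: "?w x * r x = Re (cnj c * (complex_of_real (?w x) * ((cmod (\<tau> x))\<^sup>2 * cnj (\<tau> x) * v x)))" for x
      unfolding r_def Re_mult_real[symmetric] by (simp only: mult.left_commute)
    have i: "integrable lborel (\<lambda>x. cnj c * (complex_of_real (?w x) * ((cmod (\<tau> x))\<^sup>2 * cnj (\<tau> x) * v x)))"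
      by (intro integrable_mult_right intc)
    show "integrable lborel (\<lambda>x. ?w x * r x)" unfolding eq by (rule integrable_Re[OF i])
    show "(\<integral>x. ?w x * r x \<partial>lborel) = 0"
      unfolding eq integral_Re[OF i] integral_mult_right_zero
      using fourier_extension_linear_term[OF gi g(2) \<delta>] by (simp add: \<tau>_def v_def)
  qed
  have K1: "(\<integral>x. ?w x * cmod (\<tau> x) ^ 4 \<partial>lborel) \<le> K * \<mu>\<^sup>2"
  proof -
    have "ennreal (\<integral>x. ?w x * cmod (\<tau> x) ^ 4 \<partial>lborel) = (\<integral>\<^sup>+x. ennreal (cmod (\<tau> x) ^ 4 * ?w x) \<partial>lborel)"
      by (subst nn_integral_eq_integral[symmetric, OF int4(1)]) (simp_all add: mult.commute)
    also have "\<dots> \<le> ennreal (K * \<mu>\<^sup>2)"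
      using K(2)[OF L2_sphere_const \<delta>, of 1] by (simp add: \<tau>_def L2_sphere_norm_power4 \<mu>)
    finally show ?thesis using K(1) by (simp add: ennreal_le_iff)
  qed
  have Kg: "(\<integral>x. ?w x * cmod (v x) ^ 4 \<partial>lborel) \<le> K * G\<^sup>2"
  proof -
    have "ennreal (\<integral>x. ?w x * cmod (v x) ^ 4 \<partial>lborel) = (\<integral>\<^sup>+x. ennreal (cmod (v x) ^ 4 * ?w x) \<partial>lborel)"
      by (subst nn_integral_eq_integral[symmetric, OF int4(2)]) (simp_all add: mult.commute)
    also have "\<dots> \<le> ennreal (K * G\<^sup>2)"
      using K(2)[OF g(1) \<delta>] by (simp add: v_def L2_sphere_norm_power4 G(1))
    finally show ?thesis using K(1) by (simp add: ennreal_le_iff)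
  qed
  have P1: "(\<integral>x. ?w x * cmod (\<tau> x) ^ 4 \<partial>lborel) \<le> P"
  proof -
    have "ennreal (\<integral>x. ?w x * cmod (\<tau> x) ^ 4 \<partial>lborel) = (\<integral>\<^sup>+x. ennreal (?w x * cmod (\<tau> x) ^ 4) \<partial>lborel)"
      by (subst nn_integral_eq_integral[symmetric, OF int4(1)]) simp_all
    also have "\<dots> \<le> (\<integral>\<^sup>+x. ennreal (cmod (\<tau> x) ^ 4) \<partial>lborel)"
      by (intro nn_integral_mono ennreal_leI mult_left_le_one_le) auto
    finally show ?thesis using P by (simp add: \<tau>_def ennreal_le_iff)
  qed
  have \<mu>0: "\<mu> > 0" unfolding \<mu> by (rule measure_sphere_pos)
  \<comment> \<open>Young's inequality serves in place of Cauchy-Schwarz. The weights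
    \<open>G / (2 * \<mu>)\<close> and \<open>\<mu> / (2 * G)\<close> balance
    \<open>K * \<mu>\<^sup>2\<close> against \<open>K * G\<^sup>2\<close>, so that each contributes
    half of \<open>K * \<mu> * G\<close>.\<close>
  have mixed: "(\<integral>x. ?w x * ((cmod (\<tau> x))\<^sup>2 * (cmod (v x))\<^sup>2) \<partial>lborel) \<le> K * \<mu> * G"
  proof -
    have "(\<integral>x. ?w x * ((cmod (\<tau> x))\<^sup>2 * (cmod (v x))\<^sup>2) \<partial>lborel)
      \<le> (\<integral>x. G / (2 * \<mu>) * (?w x * cmod (\<tau> x) ^ 4) + \<mu> / (2 * G) * (?w x * cmod (v x) ^ 4) \<partial>lborel)"
    proof (rule integral_mono[OF int22])
      fix x
      have amgm: "s * t \<le> G / (2 * \<mu>) * s\<^sup>2 + \<mu> / (2 * G) * t\<^sup>2" for s t :: real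
      proof -
        have "0 \<le> (G * s - \<mu> * t)\<^sup>2" by simp
        then show ?thesis using \<mu>0 G(2) by (simp add: field_simps power2_eq_square)
      qed
      have "?w x * ((cmod (\<tau> x))\<^sup>2 * (cmod (v x))\<^sup>2)
        \<le> ?w x * (G / (2 * \<mu>) * ((cmod (\<tau> x))\<^sup>2)\<^sup>2 + \<mu> / (2 * G) * ((cmod (v x))\<^sup>2)\<^sup>2)"
        by (intro mult_left_mono amgm) simp
      then show "?w x * ((cmod (\<tau> x))\<^sup>2 * (cmod (v x))\<^sup>2)
        \<le> G / (2 * \<mu>) * (?w x * cmod (\<tau> x) ^ 4) + \<mu> / (2 * G) * (?w x * cmod (v x) ^ 4)"
        by (simp add: algebra_simps)
    qed (intro Bochner_Integration.integrable_add integrable_mult_right int4)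
    also have "\<dots> = G / (2 * \<mu>) * (\<integral>x. ?w x * cmod (\<tau> x) ^ 4 \<partial>lborel) + \<mu> / (2 * G) * (\<integral>x. ?w x * cmod (v x) ^ 4 \<partial>lborel)"
      using int4 by (subst Bochner_Integration.integral_add) auto
    also have "\<dots> \<le> G / (2 * \<mu>) * (K * \<mu>\<^sup>2) + \<mu> / (2 * G) * (K * G\<^sup>2)"
      using \<mu>0 G(2) by (intro add_mono mult_left_mono K1 Kg) auto
    also have "\<dots> = K * \<mu> * G" using \<mu>0 G(2) by (simp add: field_simps power2_eq_square)
    finally show ?thesis .
  qed
  let ?t = "(cmod c)\<^sup>2"
  let ?up = "\<lambda>x. cmod c ^ 4 * (?w x * cmod (\<tau> x) ^ 4) + 4 * ?t * (?w x * r x)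
      + 8 * ?t * (?w x * ((cmod (\<tau> x))\<^sup>2 * (cmod (v x))\<^sup>2)) + 3 * (?w x * cmod (v x) ^ 4)"
  have up_int: "integrable lborel ?up"
    by (intro Bochner_Integration.integrable_add integrable_mult_right int4 int22 lin(1))
  have up: "cmod (c * \<tau> x + v x) ^ 4 * ?w x \<le> ?up x" for x
  proof -
    have r: "(cmod (c * \<tau> x))\<^sup>2 * Re (cnj (c * \<tau> x) * v x) = ?t * r x"
    proof -
      have "cnj c * (complex_of_real ((cmod (\<tau> x))\<^sup>2) * cnj (\<tau> x) * v x)
        = complex_of_real ((cmod (\<tau> x))\<^sup>2) * (cnj (c * \<tau> x) * v x)" by simp
      then have "r x = (cmod (\<tau> x))\<^sup>2 * Re (cnj (c * \<tau> x) * v x)"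
        unfolding r_def using Re_mult_real by metis
      then show ?thesis by (simp only: norm_mult power_mult_distrib mult.assoc)
    qed
    have "cmod (c * \<tau> x + v x) ^ 4 * ?w x \<le> (cmod (c * \<tau> x) ^ 4 + 4 * (cmod (c * \<tau> x))\<^sup>2 * Re (cnj (c * \<tau> x) * v x)
       + 8 * ((cmod (c * \<tau> x))\<^sup>2 * (cmod (v x))\<^sup>2) + 3 * cmod (v x) ^ 4) * ?w x"
      by (intro mult_right_mono cmod_add_power4_expansion_le) simp
    also have "4 * (cmod (c * \<tau> x))\<^sup>2 * Re (cnj (c * \<tau> x) * v x) = 4 * (?t * r x)"
      using r by (simp only: mult.assoc)
    also have "(cmod (c * \<tau> x) ^ 4 + 4 * (?t * r x)
       + 8 * ((cmod (c * \<tau> x))\<^sup>2 * (cmod (v x))\<^sup>2) + 3 * cmod (v x) ^ 4) * ?w x = ?up x"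
      by (simp add: norm_mult power_mult_distrib algebra_simps)
    finally show ?thesis .
  qed
  have "(\<integral>\<^sup>+x. ennreal (cmod (fourier_extension (\<lambda>\<omega>. c + g \<omega>) x) ^ 4 * ?w x) \<partial>lborel) \<le> (\<integral>\<^sup>+x. ennreal (?up x) \<partial>lborel)"
    unfolding T by (intro nn_integral_mono ennreal_leI up)
  \<comment> \<open>The linear term has no sign, but \<open>?up\<close> is nonnegative because it
    dominates a weighted fourth power.\<close>
  also have "\<dots> = ennreal (\<integral>x. ?up x \<partial>lborel)"
    by (rule nn_integral_eq_integral[OF up_int]) (intro AE_I2 order_trans[OF _ up], simp)
  also have "(\<integral>x. ?up x \<partial>lborel) = cmod c ^ 4 * (\<integral>x. ?w x * cmod (\<tau> x) ^ 4 \<partial>lborel) + 4 * ?t * (\<integral>x. ?w x * r x \<partial>lborel)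
      + 8 * ?t * (\<integral>x. ?w x * ((cmod (\<tau> x))\<^sup>2 * (cmod (v x))\<^sup>2) \<partial>lborel) + 3 * (\<integral>x. ?w x * cmod (v x) ^ 4 \<partial>lborel)"
    by (simp only: Bochner_Integration.integral_add Bochner_Integration.integrable_add integrable_mult_right int4 int22 lin(1) integral_mult_right_zero)
  also have "ennreal \<dots> \<le> ennreal (cmod c ^ 4 * P + 4 * ?t * 0 + 8 * ?t * (K * \<mu> * G) + 3 * (K * G\<^sup>2))"
    unfolding lin(2) by (intro ennreal_leI add_mono mult_left_mono P1 mixed Kg order_refl) auto
  also have "cmod c ^ 4 * P + 4 * ?t * 0 + 8 * ?t * (K * \<mu> * G) + 3 * (K * G\<^sup>2) = ?B"
    by (simp add: algebra_simps)
  finally show "(\<integral>\<^sup>+x. ennreal (cmod (fourier_extension (\<lambda>\<omega>. c + g \<omega>) x) ^ 4 * ?w x) \<partial>lborel) \<le> ennreal ?B" .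
qed

section \<open>Comparison of the quotients\<close>

lemma extension_quotient_eq:
  fixes f :: "real ^ 'n \<Rightarrow> complex"
  assumes f: "f \<in> L2_sphere" and Q: "Q \<ge> 0" "(\<integral>\<^sup>+x. ennreal (cmod (fourier_extension f x) ^ 4) \<partial>lborel) = ennreal Q"
    and N: "L2_sphere_norm f ^ 4 > 0" and a: "a \<ge> 0"
  shows "extension_quotient a f = ennreal ((Q / (2 * pi) ^ CARD('n) + a * cmod (\<integral>\<omega>. f \<omega> \<partial>sphere_measure) ^ 4) / L2_sphere_norm f ^ 4)"
proof -
  let ?Z = "(2 * pi) ^ CARD('n)"
  have m: "(\<lambda>x. ennreal (cmod (fourier_extension f x) ^ 4)) \<in> borel_measurable lborel"
    by (simp only: measurable_lborel2)
       (intro measurable_compose[OF _ measurable_ennreal] borel_measurable_power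
          measurable_compose[OF _ borel_measurable_norm] borel_measurable_fourier_extension L2_sphere_measurable f)
  have "(\<integral>\<^sup>+x. ennreal (cmod (fourier_extension f x) ^ 4 / ?Z) \<partial>lborel)
    = (\<integral>\<^sup>+x. ennreal (1 / ?Z) * ennreal (cmod (fourier_extension f x) ^ 4) \<partial>lborel)"
    by (intro nn_integral_cong) (simp flip: ennreal_mult)
  also have "\<dots> = ennreal (1 / ?Z) * ennreal Q"
    unfolding nn_integral_cmult[OF m] Q(2) ..
  also have "\<dots> = ennreal (Q / ?Z)" using Q(1) by (simp flip: ennreal_mult)
  finally have 1: "(\<integral>\<^sup>+x. ennreal (cmod (fourier_extension f x) ^ 4 / ?Z) \<partial>lborel) = ennreal (Q / ?Z)" .
  have nn: "Q / ?Z \<ge> 0" "a * cmod (\<integral>\<omega>. f \<omega> \<partial>sphere_measure) ^ 4 \<ge> 0" using Q(1) a by simp_all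
  show ?thesis
    unfolding extension_quotient_def 1 ennreal_plus[OF nn, symmetric]
    by (rule divide_ennreal) (use nn N in \<open>auto intro: add_nonneg_nonneg\<close>)
qed

text \<open>In the application \<open>t\<close> is \<open>(cmod c)\<^sup>2\<close>, \<open>G\<close>
  is the squared norm of \<open>g\<close>, and \<open>k\<close>, \<open>p\<close> are
  \<open>K\<close>, \<open>P\<close> divided by (2 pi)^d. After clearing denominators, the term with
  \<open>a\<close> gains \<open>a * \<mu> ^ 4 * (2 * t * \<mu> * G + G\<^sup>2)\<close> and has to
  beat \<open>\<mu>\<^sup>2 * (8 * k * t * \<mu> * G + 3 * k * G\<^sup>2)\<close>. The part
  \<open>4 * k\<close> of the numerator of \<open>a\<close> exactly balances the mixed term; the
  extra 1 makes the inequality strict, even for \<open>t = 0\<close>.\<close>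

lemma perturbed_quotient_less:
  fixes \<mu> G t k p q a :: real
  assumes "\<mu> > 0" "G > 0" "t \<ge> 0" "k \<ge> 0" "p \<ge> 0"
    and a: "a = (4 * k + 1) / \<mu>\<^sup>2"
    and q: "q \<le> t\<^sup>2 * p + 8 * k * (t * \<mu> * G) + 3 * k * G\<^sup>2"
  shows "(q + a * (t\<^sup>2 * \<mu> ^ 4)) / (t * \<mu> + G)\<^sup>2 < (p + a * \<mu> ^ 4) / \<mu>\<^sup>2"
proof -
  have am: "a * \<mu> ^ 4 = (4 * k + 1) * \<mu>\<^sup>2"
    using assms(1) by (simp add: a power4_eq_xxxx power2_eq_square)
  have "(q + a * (t\<^sup>2 * \<mu> ^ 4)) * \<mu>\<^sup>2 = q * \<mu>\<^sup>2 + t\<^sup>2 * (a * \<mu> ^ 4) * \<mu>\<^sup>2"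
    by (simp add: algebra_simps)
  also have "\<dots> \<le> (t\<^sup>2 * p + 8 * k * (t * \<mu> * G) + 3 * k * G\<^sup>2) * \<mu>\<^sup>2 + t\<^sup>2 * (a * \<mu> ^ 4) * \<mu>\<^sup>2"
    using q by (intro add_right_mono mult_right_mono) auto
  also have "\<dots> < (p + a * \<mu> ^ 4) * (t * \<mu> + G)\<^sup>2"
  proof -
    have "(p + a * \<mu> ^ 4) * (t * \<mu> + G)\<^sup>2
      - ((t\<^sup>2 * p + 8 * k * (t * \<mu> * G) + 3 * k * G\<^sup>2) * \<mu>\<^sup>2 + t\<^sup>2 * (a * \<mu> ^ 4) * \<mu>\<^sup>2)
      = p * (2 * t * \<mu> * G + G\<^sup>2) + \<mu>\<^sup>2 * (2 * t * \<mu> * G + k * G\<^sup>2 + G\<^sup>2)"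
      unfolding am by (simp add: power2_eq_square algebra_simps)
    moreover have "\<dots> > 0"
      using assms(1-5) by (intro add_nonneg_pos mult_pos_pos add_nonneg_pos mult_nonneg_nonneg add_nonneg_nonneg) auto
    ultimately show ?thesis by linarith
  qed
  finally have "(q + a * (t\<^sup>2 * \<mu> ^ 4)) * \<mu>\<^sup>2 - (p + a * \<mu> ^ 4) * (t * \<mu> + G)\<^sup>2 < 0" by simp
  moreover have "0 < t * \<mu> + G" using assms(1-3) by (intro add_nonneg_pos) auto
  ultimately show ?thesis
    using assms(1) by (subst frac_less_eq) (auto intro!: divide_neg_pos)
qed

theorem theorem1p1:
  assumes "CARD('n::finite) \<ge> 3"
  shows "\<exists>a>0. \<forall>f :: real ^ 'n \<Rightarrow> complex.
           f \<in> L2_sphere \<and> \<not> (AE \<omega> in sphere_measure. f \<omega> = 0) \<longrightarrow>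
             extension_quotient a f \<le> extension_quotient a (\<lambda>_ :: real ^ 'n. 1)
           \<and> (extension_quotient a f = extension_quotient a (\<lambda>_ :: real ^ 'n. 1)
                \<longleftrightarrow> (\<exists>c. AE \<omega> in sphere_measure. f \<omega> = c))"
proof -
  let ?\<sigma> = "sphere_measure :: (real ^ 'n) measure"
  let ?Z = "(2 * pi) ^ CARD('n)"
  let ?one = "\<lambda>_ :: real ^ 'n. 1 :: complex"
  obtain K where K: "K \<ge> 0" "\<And>(f :: real ^ 'n \<Rightarrow> complex) \<delta>. f \<in> L2_sphere \<Longrightarrow> \<delta> > 0 \<Longrightarrow>
      (\<integral>\<^sup>+x. ennreal (cmod (fourier_extension f x) ^ 4 * gauss_weight \<delta> x) \<partial>lborel)
        \<le> ennreal (K * L2_sphere_norm f ^ 4)"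
    using fourier_extension_L4_bound[OF assms] by blast
  define \<mu> where "\<mu> = measure ?\<sigma> (sphere 0 1)"
  have \<mu>: "\<mu> > 0" unfolding \<mu>_def by (rule measure_sphere_pos)
  have norm1: "L2_sphere_norm ?one ^ 4 = \<mu>\<^sup>2" by (simp add: L2_sphere_norm_power4 \<mu>_def)
  have int1: "(\<integral>\<omega>. ?one \<omega> \<partial>?\<sigma>) = \<mu>" by (simp add: \<mu>_def scaleR_conv_of_real)
  let ?I = "\<lambda>f. \<integral>\<^sup>+x. ennreal (cmod (fourier_extension f x) ^ 4) \<partial>(lborel :: (real ^ 'n) measure)"
  have m4: "(\<lambda>x. cmod (fourier_extension f x) ^ 4) \<in> borel_measurable borel" if "f \<in> L2_sphere" for f :: "real ^ 'n \<Rightarrow> complex"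
    by (intro borel_measurable_power measurable_compose[OF _ borel_measurable_norm]
        borel_measurable_fourier_extension L2_sphere_measurable that)
  \<comment> \<open>The L^4 bound shows that the integral for the constant function is finite, so
    \<open>P\<close> is a real number and the comparison can take place in the reals.\<close>
  have "?I ?one \<le> ennreal (K * L2_sphere_norm ?one ^ 4)"
    by (rule nn_integral_le_of_gauss_weighted_le[OF m4[OF L2_sphere_const] K(2)[OF L2_sphere_const]])
  then have "?I ?one < \<top>" by (rule le_less_trans) simp
  then obtain P where P: "P \<ge> 0" "?I ?one = ennreal P"
    by (cases "?I ?one") auto
  define k p a where "k = K / ?Z" and "p = P / ?Z" and "a = (4 * k + 1) / \<mu>\<^sup>2"
  have kp: "k \<ge> 0" "p \<ge> 0" using K(1) P(1) by (simp_all add: k_def p_def)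
  have a: "a > 0" unfolding a_def using \<mu> kp(1) by (intro divide_pos_pos) auto
  have E1: "extension_quotient a ?one = ennreal ((p + a * \<mu> ^ 4) / \<mu>\<^sup>2)"
  proof -
    have "L2_sphere_norm ?one ^ 4 > 0" unfolding norm1 using \<mu> by simp
    from extension_quotient_eq[OF L2_sphere_const P this less_imp_le[OF a], unfolded int1 norm1]
    show ?thesis using \<mu> by (simp add: p_def)
  qed
  have main: "extension_quotient a f \<le> extension_quotient a ?one \<and>
     (extension_quotient a f = extension_quotient a ?one \<longleftrightarrow> (\<exists>c. AE \<omega> in ?\<sigma>. f \<omega> = c))"
    if f: "f \<in> L2_sphere" and f0: "\<not> (AE \<omega> in ?\<sigma>. f \<omega> = 0)" for f :: "real ^ 'n \<Rightarrow> complex"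
  proof (cases "\<exists>c. AE \<omega> in ?\<sigma>. f \<omega> = c")
    case True
    then obtain c where c: "AE \<omega> in ?\<sigma>. f \<omega> = c" by blast
    \<comment> \<open>Numerator and denominator are both homogeneous of degree 4, so a nonzero
      constant has the same quotient as 1, and changes on null sets affect none of the
      integrals.\<close>
    have "c \<noteq> 0" using c f0 by auto
    note fm = L2_sphere_measurable[OF f]
    have int: "(\<integral>\<omega>. f \<omega> \<partial>?\<sigma>) = c * \<mu>"
    proof -
      have "(\<integral>\<omega>. f \<omega> \<partial>?\<sigma>) = (\<integral>\<omega>. c \<partial>?\<sigma>)" by (rule integral_cong_AE) (use c fm in auto)
      then show ?thesis by (simp add: \<mu>_def scaleR_conv_of_real)
    qed
    have "(\<integral>\<omega>. (cmod (f \<omega>))\<^sup>2 \<partial>?\<sigma>) = (\<integral>\<omega>. (cmod c)\<^sup>2 \<partial>?\<sigma>)"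
    proof (rule integral_cong_AE)
      show "(\<lambda>\<omega>. (cmod (f \<omega>))\<^sup>2) \<in> borel_measurable ?\<sigma>" using fm by measurable
    qed (use c in auto)
    then have norm: "L2_sphere_norm f ^ 4 = (cmod c)\<^sup>2 ^ 2 * \<mu>\<^sup>2"
      by (simp add: L2_sphere_norm_power4 \<mu>_def power_mult_distrib)
    have T: "fourier_extension f x = c * fourier_extension ?one x" for x
    proof -
      have "fourier_extension f x = fourier_extension (\<lambda>\<omega>. c * ?one \<omega>) x"
        unfolding fourier_extension_def
      proof (rule integral_cong_AE)
        show "(\<lambda>\<omega>. f \<omega> * exp (\<i> * complex_of_real (\<omega> \<bullet> x))) \<in> borel_measurable ?\<sigma>" using fm by measurable
      qed (use c in auto)
      then show ?thesis by (simp only: fourier_extension_cmult)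
    qed
    have "?I f = (\<integral>\<^sup>+x. ennreal (cmod c ^ 4) * ennreal (cmod (fourier_extension ?one x) ^ 4) \<partial>lborel)"
      unfolding T norm_mult power_mult_distrib by (intro nn_integral_cong ennreal_mult) auto
    also have "\<dots> = ennreal (cmod c ^ 4) * ?I ?one"
      using m4[OF L2_sphere_const[of 1]] by (intro nn_integral_cmult) simp
    finally have Q: "?I f = ennreal (cmod c ^ 4 * P)" using P by (simp add: ennreal_mult)
    have "extension_quotient a f = ennreal ((cmod c ^ 4 * P / ?Z + a * cmod (c * \<mu>) ^ 4) / ((cmod c)\<^sup>2 ^ 2 * \<mu>\<^sup>2))"
      using extension_quotient_eq[OF f _ Q, of a] P(1) a \<mu> \<open>c \<noteq> 0\<close> unfolding norm int by simp
    also have "(cmod c ^ 4 * P / ?Z + a * cmod (c * \<mu>) ^ 4) / ((cmod c)\<^sup>2 ^ 2 * \<mu>\<^sup>2) = (p + a * \<mu> ^ 4) / \<mu>\<^sup>2"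
    proof -
      have "cmod c ^ 4 * P / ?Z + a * cmod (c * \<mu>) ^ 4 = cmod c ^ 4 * (p + a * \<mu> ^ 4)"
        using \<mu> by (simp add: p_def norm_mult power_mult_distrib algebra_simps)
      moreover have "(cmod c)\<^sup>2 ^ 2 = cmod c ^ 4" by simp
      moreover have "cmod c ^ 4 \<noteq> 0" using \<open>c \<noteq> 0\<close> by simp
      ultimately show ?thesis by (metis mult_divide_mult_cancel_left)
    qed
    finally show ?thesis using True by (simp add: E1)
  next
    case False
    \<comment> \<open>With \<open>c\<close> the mean value of \<open>f\<close>, the remainder
      \<open>g\<close> is orthogonal to the constants, and the squared norm of \<open>f\<close>
      splits as \<open>(cmod c)\<^sup>2 * \<mu> + G\<close>.\<close>
    define c where "c = (\<integral>\<omega>. f \<omega> \<partial>?\<sigma>) / \<mu>"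
    define g where "g \<omega> = f \<omega> - c" for \<omega>
    define G where "G = (\<integral>\<omega>. (cmod (g \<omega>))\<^sup>2 \<partial>?\<sigma>)"
    note fi = L2_sphere_integrable[OF f] and fm = L2_sphere_measurable[OF f]
    have int: "(\<integral>\<omega>. f \<omega> \<partial>?\<sigma>) = c * \<mu>" using \<mu> by (simp add: c_def)
    have gm: "g \<in> borel_measurable ?\<sigma>" unfolding g_def using fm by simp
    have sq: "(cmod (g \<omega>))\<^sup>2 = (cmod (f \<omega>))\<^sup>2 - 2 * Re (cnj c * f \<omega>) + (cmod c)\<^sup>2" for \<omega>
      unfolding g_def cmod_power2 by (simp add: power2_eq_square algebra_simps)
    have i1: "integrable ?\<sigma> (\<lambda>\<omega>. cnj c * f \<omega>)" using fi by simp
    note f2 = L2_sphere_square_integrable[OF f]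
    have g2: "integrable ?\<sigma> (\<lambda>\<omega>. (cmod (g \<omega>))\<^sup>2)"
      unfolding sq by (intro Bochner_Integration.integrable_add Bochner_Integration.integrable_diff integrable_mult_right
          integrable_Re i1 f2) simp
    have g: "g \<in> L2_sphere" using gm g2 by (simp add: L2_sphere_def)
    have g0: "(\<integral>\<omega>. g \<omega> \<partial>?\<sigma>) = 0"
      unfolding g_def using fi by (simp add: int) (simp add: \<mu>_def scaleR_conv_of_real)
    have G_eq: "(\<integral>\<omega>. (cmod (f \<omega>))\<^sup>2 \<partial>?\<sigma>) = (cmod c)\<^sup>2 * \<mu> + G"
    proof -
      have "G = (\<integral>\<omega>. (cmod (f \<omega>))\<^sup>2 \<partial>?\<sigma>) - 2 * (\<integral>\<omega>. Re (cnj c * f \<omega>) \<partial>?\<sigma>) + (cmod c)\<^sup>2 * \<mu>"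
      proof -
        define r where "r \<omega> = Re (cnj c * f \<omega>)" for \<omega>
        have "integrable ?\<sigma> r" unfolding r_def by (rule integrable_Re[OF i1])
        then show ?thesis
          unfolding G_def sq r_def[symmetric] using f2 by (simp add: \<mu>_def)
      qed
      moreover have "(\<integral>\<omega>. Re (cnj c * f \<omega>) \<partial>?\<sigma>) = (cmod c)\<^sup>2 * \<mu>"
      proof -
        have "(\<integral>\<omega>. Re (cnj c * f \<omega>) \<partial>?\<sigma>) = Re (cnj c * (c * \<mu>))"
          unfolding integral_Re[OF i1] integral_mult_right_zero int ..
        also have "\<dots> = (cmod c)\<^sup>2 * \<mu>" unfolding cmod_power2 by (simp add: power2_eq_square algebra_simps)
        finally show ?thesis .
      qed
      ultimately show ?thesis by simp
    qed
    have "G \<ge> 0" unfolding G_def by simp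
    \<comment> \<open>If \<open>G\<close> were 0, then \<open>f\<close> would be constant almost
      everywhere, contrary to the present case. The strict bound obtained from \<open>G > 0\<close>
      settles the inequality and its equality case together.\<close>
    moreover have "G \<noteq> 0"
    proof
      assume "G = 0"
      then have "AE \<omega> in ?\<sigma>. (cmod (g \<omega>))\<^sup>2 = 0"
        unfolding G_def using integral_nonneg_eq_0_iff_AE[OF g2] by simp
      then have "AE \<omega> in ?\<sigma>. f \<omega> = c" by (simp add: g_def)
      with False show False by blast
    qed
    ultimately have G: "G > 0" by simp
    let ?t = "(cmod c)\<^sup>2"
    have fg: "f = (\<lambda>\<omega>. c + g \<omega>)" by (simp add: g_def)
    have le: "?I f \<le> ennreal (cmod c ^ 4 * P + 8 * K * (?t * \<mu> * G) + 3 * K * G\<^sup>2)"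
      unfolding fg by (rule fourier_extension_L4_perturbation[OF K P g g0 G_def G \<mu>_def])
    then have "?I f < \<top>" by (rule le_less_trans) simp
    then obtain Q where Q: "Q \<ge> 0" "?I f = ennreal Q"
      by (cases "?I f") auto
    have "0 \<le> cmod c ^ 4 * P + 8 * K * (?t * \<mu> * G) + 3 * K * G\<^sup>2"
      using K(1) P(1) \<mu> G by simp
    then have "Q \<le> cmod c ^ 4 * P + 8 * K * (?t * \<mu> * G) + 3 * K * G\<^sup>2"
      using le Q by (simp add: ennreal_le_iff)
    then have "Q / ?Z \<le> (cmod c ^ 4 * P + 8 * K * (?t * \<mu> * G) + 3 * K * G\<^sup>2) / ?Z"
      by (intro divide_right_mono) auto
    then have q: "Q / ?Z \<le> ?t\<^sup>2 * p + 8 * k * (?t * \<mu> * G) + 3 * k * G\<^sup>2"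
      by (simp add: k_def p_def add_divide_distrib)
    have norm: "L2_sphere_norm f ^ 4 = (?t * \<mu> + G)\<^sup>2"
      by (simp only: L2_sphere_norm_power4 G_eq)
    have "?t * \<mu> + G > 0" using \<mu> G by (intro add_nonneg_pos) auto
    then have "extension_quotient a f = ennreal ((Q / ?Z + a * cmod (c * \<mu>) ^ 4) / (?t * \<mu> + G)\<^sup>2)"
      using extension_quotient_eq[OF f Q, of a] a unfolding norm int by simp
    also have "cmod (c * \<mu>) ^ 4 = ?t\<^sup>2 * \<mu> ^ 4"
      using \<mu> by (simp add: norm_mult power_mult_distrib)
    finally have "extension_quotient a f = ennreal ((Q / ?Z + a * (?t\<^sup>2 * \<mu> ^ 4)) / (?t * \<mu> + G)\<^sup>2)" .
    also have "\<dots> < ennreal ((p + a * \<mu> ^ 4) / \<mu>\<^sup>2)"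
    proof (rule ennreal_lessI)
      show "(Q / ?Z + a * (?t\<^sup>2 * \<mu> ^ 4)) / (?t * \<mu> + G)\<^sup>2 < (p + a * \<mu> ^ 4) / \<mu>\<^sup>2"
        by (rule perturbed_quotient_less[OF \<mu> G _ kp a_def q]) simp
      show "0 < (p + a * \<mu> ^ 4) / \<mu>\<^sup>2"
        using \<mu> kp(2) a by (intro divide_pos_pos add_nonneg_pos) auto
    qed
    finally have "extension_quotient a f < extension_quotient a ?one" by (simp only: E1)
    then show ?thesis using False by auto
  qed
  show ?thesis using a main by blast
qed

end
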